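(* Let $G$ be a simple connected graph of order $n$. (i) If $n\geq 16$ or $n\in\{12,14\}$, and $\eta(G)\leq \eta\big(K_1 \vee (K_{n-3}+\overline{K_2})\big)$, then $G$ has a $\{K_2,\{C_k\}\}$-factor, unless $G\cong K_1 \vee (K_{n-3}+\overline{K_2})$. (ii) If $3\leq n\leq 11$, $n=13$ or $n=15$, and $\eta(G)\leq \eta(\widehat{G})$, then $G$ has a $\{K_2,\{C_k\}\}$-factor, unless $G\cong\widehat{G}$, where $\widehat{G}=K_{\frac{n-1}{2}} \vee \overline{K_{\frac{n+1}{2}}}$ if $n$ is odd and $\widehat{G}=K_{\frac{n}{2}-1} \vee \overline{K_{\frac{n}{2}+1}}$ if $n$ is even.
   Context: All graphs are finite, simple, undirected and connected. For a connected graph $G$ with vertices $v_1,\dots,v_n$, $d_G(v_i,v_j)$ is the length of a shortest $v_i$–$v_j$ path, $D(G)=(d_G(v_i,v_j))$ is the distance matrix, $\mathrm{Tr}_G(v_i)=\sum_{j} d_G(v_i,v_j)$ is the transmission of $v_i$, and $\mathrm{Tr}(G)=\mathrm{diag}(\mathrm{Tr}_G(v_1),\dots,\mathrm{Tr}_G(v_n))$. The distance signless Laplacian matrix is $Q(G)=\mathrm{Tr}(G)+D(G)$, and $\eta(G)$ denotes its largest eigenvalue. A $\{K_2,\{C_k\}\}$-factor of $G$ is a spanning subgraph of $G$ each of whose connected components is isomorphic either to $K_2$ or to a cycle $C_k$ for some integer $k\geq 3$ (the cycle lengths may vary between components). $K_m$ is the complete graph on $m$ vertices, $\overline{K_m}$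 is the edgeless graph on $m$ vertices, $G_1+G_2$ denotes the vertex-disjoint union of $G_1$ and $G_2$, and $G_1\vee G_2$ (join) is obtained from the disjoint union by adding all edges between $V(G_1)$ and $V(G_2)$. *)

theory Defs
  imports
    "Graph_Theory.Graph_Theory"
    "Jordan_Normal_Form.Char_Poly"
begin

text \<open>
  A simple undirected graph is a \<open>pair_graph\<close>: finitely many vertices and a symmetric irreflexive
  set of arcs, so that an edge is represented by its two orientations.
\<close>

definition complete_graph :: "nat \<Rightarrow> nat pair_pre_digraph" where
  "complete_graph m = \<lparr> pverts = {..<m}, parcs = {(i, j). i < m \<and> j < m \<and> i \<noteq> j} \<rparr>"

definition edgeless_graph :: "nat \<Rightarrow> nat pair_pre_digraph" where
  "edgeless_graph m = \<lparr> pverts = {..<m}, parcs = {} \<rparr>"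

definition cycle_graph :: "nat \<Rightarrow> nat pair_pre_digraph" where
  "cycle_graph k = \<lparr> pverts = {..<k},
     parcs = {(i, j). i < k \<and> j < k \<and> (j = Suc i mod k \<or> i = Suc j mod k)} \<rparr>"

definition disjoint_union ::
    "'a pair_pre_digraph \<Rightarrow> 'b pair_pre_digraph \<Rightarrow> ('a + 'b) pair_pre_digraph" where
  "disjoint_union G H = \<lparr> pverts = Inl ` pverts G \<union> Inr ` pverts H,
     parcs = map_prod Inl Inl ` parcs G \<union> map_prod Inr Inr ` parcs H \<rparr>"

definition graph_join ::
    "'a pair_pre_digraph \<Rightarrow> 'b pair_pre_digraph \<Rightarrow> ('a + 'b) pair_pre_digraph" where
  "graph_join G H = \<lparr> pverts = pverts (disjoint_union G H),
     parcs = parcs (disjoint_union G H)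
       \<union> Inl ` pverts G \<times> Inr ` pverts H \<union> Inr ` pverts H \<times> Inl ` pverts G \<rparr>"

definition graph_iso :: "'a pair_pre_digraph \<Rightarrow> 'b pair_pre_digraph \<Rightarrow> bool" where
  "graph_iso G H \<longleftrightarrow> digraph_iso (with_proj G) (with_proj H)"

text \<open>
  The components of \<open>F\<close> are its strongly connected components in the sense of the library;
  as \<open>F\<close> is symmetric, these are the connected components of the undirected graph.
\<close>

definition is_K2_Ck_factor :: "'a pair_pre_digraph \<Rightarrow> 'a pair_pre_digraph \<Rightarrow> bool" where
  "is_K2_Ck_factor F G \<longleftrightarrow> pair_graph F \<and> spanning (with_proj F) (with_proj G) \<and>
     (\<forall>C \<in> pre_digraph.sccs (with_proj F).
        digraph_iso C (with_proj (complete_graph 2)) \<or>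
        (\<exists>k\<ge>3. digraph_iso C (with_proj (cycle_graph k))))"

definition has_K2_Ck_factor :: "'a pair_pre_digraph \<Rightarrow> bool" where
  "has_K2_Ck_factor G \<longleftrightarrow> (\<exists>F. is_K2_Ck_factor F G)"

text \<open>The distance is only meaningful for vertices that are joined by some path.\<close>

definition gdist :: "'a pair_pre_digraph \<Rightarrow> 'a \<Rightarrow> 'a \<Rightarrow> nat" where
  "gdist G u v = (LEAST k. \<exists>p. pre_digraph.apath (with_proj G) u p v \<and> length p = k)"

definition transmission :: "'a pair_pre_digraph \<Rightarrow> 'a \<Rightarrow> nat" where
  "transmission G v = (\<Sum>u \<in> pverts G. gdist G v u)"

text \<open>
  In the matrices below, the list \<open>vs\<close> is an enumeration \<open>v\<^sub>1, \<dots>, v\<^sub>n\<close> of the vertices of \<open>G\<close>.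
\<close>

definition distance_matrix :: "'a pair_pre_digraph \<Rightarrow> 'a list \<Rightarrow> real mat" where
  "distance_matrix G vs =
     mat (length vs) (length vs) (\<lambda>(i, j). real (gdist G (vs ! i) (vs ! j)))"

definition transmission_matrix :: "'a pair_pre_digraph \<Rightarrow> 'a list \<Rightarrow> real mat" where
  "transmission_matrix G vs =
     mat (length vs) (length vs) (\<lambda>(i, j). if i = j then real (transmission G (vs ! i)) else 0)"

definition distance_signless_laplacian :: "'a pair_pre_digraph \<Rightarrow> 'a list \<Rightarrow> real mat" where
  "distance_signless_laplacian G vs = transmission_matrix G vs + distance_matrix G vs"

definition vertex_list :: "'a pair_pre_digraph \<Rightarrow> 'a list" where
  "vertex_list G = (SOME vs. distinct vs \<and> set vs = pverts G)"

text \<open>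
  The largest eigenvalue of the (real symmetric) matrix \<open>Q(G)\<close>. The enumeration of the vertices
  chosen by \<open>vertex_list\<close> is irrelevant, see \<open>eta_eq\<close> below.
\<close>

definition eta :: "'a pair_pre_digraph \<Rightarrow> real" where
  "eta G = Max {x. eigenvalue (distance_signless_laplacian G (vertex_list G)) x}"

text \<open>
  The join of \<open>K\<^sub>1\<close> with the disjoint union of \<open>K\<^sub>n\<^sub>-\<^sub>3\<close> and two isolated vertices; meant for
  \<open>n \<ge> 3\<close>, where the subtraction is exact.
\<close>

definition pendant_graph :: "nat \<Rightarrow> (nat + nat + nat) pair_pre_digraph" where
  "pendant_graph n =
     graph_join (complete_graph 1) (disjoint_union (complete_graph (n - 3)) (edgeless_graph 2))"

text \<open>The graph written \<open>G\<close> with a hat; all subtractions and divisions are exact for \<open>n \<ge> 2\<close>.\<close>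

definition hat_graph :: "nat \<Rightarrow> (nat + nat) pair_pre_digraph" where
  "hat_graph n =
     (if odd n then graph_join (complete_graph ((n - 1) div 2)) (edgeless_graph ((n + 1) div 2))
      else graph_join (complete_graph (n div 2 - 1)) (edgeless_graph (n div 2 + 1)))"


lemma pair_graph_iff:
  "pair_graph G \<longleftrightarrow> finite (pverts G) \<and> parcs G \<subseteq> pverts G \<times> pverts G \<and> sym (parcs G)
     \<and> irrefl (parcs G)"
proof
  assume "pair_graph G"
  then interpret pair_graph G .
  show "finite (pverts G) \<and> parcs G \<subseteq> pverts G \<times> pverts G \<and> sym (parcs G) \<and> irrefl (parcs G)"
    using pair_finite_verts wellformed' pair_sym_arcs
    by (auto simp: symmetric_def irrefl_def dest: pair_no_loops)
next
  assume *: "finite (pverts G) \<and> parcs G \<subseteq> pverts G \<times> pverts G \<and> sym (parcs G) \<and> irrefl (parcs G)"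
  then have "finite (parcs G)"
    by (meson finite_SigmaI finite_subset)
  with * show "pair_graph G"
    by unfold_locales (auto simp: symmetric_def irrefl_def)
qed

lemma pair_graph_complete_graph: "pair_graph (complete_graph m)"
  by (auto simp: pair_graph_iff complete_graph_def sym_def irrefl_def)

lemma complete_digraph_complete_graph: "complete_digraph m (with_proj (complete_graph m))"
  by (auto simp: complete_digraph_pair_def complete_graph_def)

lemma pair_graph_edgeless_graph: "pair_graph (edgeless_graph m)"
  by (auto simp: pair_graph_iff edgeless_graph_def sym_def irrefl_def)

lemma pair_graph_cycle_graph: "k \<ge> 2 \<Longrightarrow> pair_graph (cycle_graph k)"
  by (auto simp: pair_graph_iff cycle_graph_def sym_def irrefl_def mod_Suc)

lemma pair_graph_disjoint_union:
  "pair_graph G \<Longrightarrow> pair_graph H \<Longrightarrow> pair_graph (disjoint_union G H)"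
  unfolding pair_graph_iff by (fastforce simp: disjoint_union_def sym_def irrefl_def)

lemma pair_graph_graph_join:
  "pair_graph G \<Longrightarrow> pair_graph H \<Longrightarrow> pair_graph (graph_join G H)"
  using pair_graph_disjoint_union[of G H]
  unfolding pair_graph_iff
  by (auto simp: graph_join_def sym_def irrefl_def) (auto simp: disjoint_union_def)

lemma card_pverts_pendant_graph: "n \<ge> 3 \<Longrightarrow> card (pverts (pendant_graph n)) = n"
  by (auto simp: pendant_graph_def graph_join_def disjoint_union_def complete_graph_def
      edgeless_graph_def card_image image_Un Plus_def[symmetric] card_Plus)

lemma card_pverts_hat_graph: "n \<ge> 2 \<Longrightarrow> card (pverts (hat_graph n)) = n"
  by (auto simp: hat_graph_def graph_join_def disjoint_union_def complete_graph_def
      edgeless_graph_def Plus_def[symmetric] card_Plus elim!: oddE evenE)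

lemma eigenvalue_distance_signless_laplacian_iff:
  assumes "distinct vs" "set vs = pverts G"
  shows "eigenvalue (distance_signless_laplacian G vs) x \<longleftrightarrow>
    (\<exists>f. (\<exists>v \<in> pverts G. f v \<noteq> 0) \<and>
         (\<forall>v \<in> pverts G. real (transmission G v) * f v
            + (\<Sum>u \<in> pverts G. real (gdist G v u) * f u) = x * f v))"
    (is "_ \<longleftrightarrow> (\<exists>f. ?nz f \<and> (\<forall>v \<in> pverts G. ?L f v = x * f v))")
proof -
  let ?n = "length vs" and ?Q = "distance_signless_laplacian G vs"
  have dim: "dim_row ?Q = ?n" "dim_col ?Q = ?n"
    by (simp_all add: distance_signless_laplacian_def transmission_matrix_def distance_matrix_def)
  have sum_vs: "(\<Sum>j<?n. g (vs ! j)) = (\<Sum>u \<in> pverts G. g u)" for g :: "'a \<Rightarrow> real"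
    using sum.reindex_bij_betw[OF bij_betw_nth[OF assms(1) refl refl], of g] assms(2)
    by simp
  have mult: "(?Q *\<^sub>v vec ?n (\<lambda>i. f (vs ! i))) $ i = ?L f (vs ! i)"
    if i: "i < ?n" for f :: "'a \<Rightarrow> real" and i
  proof -
    have "(?Q *\<^sub>v vec ?n (\<lambda>i. f (vs ! i))) $ i =
        (\<Sum>j<?n. (if i = j then real (transmission G (vs ! i)) * f (vs ! j) else 0)
           + real (gdist G (vs ! i) (vs ! j)) * f (vs ! j))"
      using i by (auto simp: scalar_prod_def dim lessThan_atLeast0 distance_signless_laplacian_def
          transmission_matrix_def distance_matrix_def algebra_simps intro!: sum.cong)
    also have "\<dots> = ?L f (vs ! i)"
      using i sum_vs[of "\<lambda>u. real (gdist G (vs ! i) u) * f u"] by (simp add: sum.distrib)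
    finally show ?thesis .
  qed
  have key: "eigenvector ?Q (vec ?n (\<lambda>i. f (vs ! i))) x \<longleftrightarrow>
      ?nz f \<and> (\<forall>v \<in> pverts G. ?L f v = x * f v)" for f :: "'a \<Rightarrow> real"
  proof -
    have "vec ?n (\<lambda>i. f (vs ! i)) \<noteq> 0\<^sub>v ?n \<longleftrightarrow> ?nz f"
      unfolding assms(2)[symmetric] vec_eq_iff by simp (metis in_set_conv_nth)
    moreover have "?Q *\<^sub>v vec ?n (\<lambda>i. f (vs ! i)) = x \<cdot>\<^sub>v vec ?n (\<lambda>i. f (vs ! i)) \<longleftrightarrow>
        (\<forall>i<?n. ?L f (vs ! i) = x * f (vs ! i))"
      unfolding vec_eq_iff using mult dim by (auto simp del: index_mult_mat_vec)
    moreover have "(\<forall>i<?n. ?L f (vs ! i) = x * f (vs ! i)) \<longleftrightarrow>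
        (\<forall>v \<in> pverts G. ?L f v = x * f v)"
      using all_set_conv_all_nth[of vs "\<lambda>v. ?L f v = x * f v"] by (simp only: assms(2))
    ultimately show ?thesis
      by (simp only: eigenvector_def dim) simp
  qed
  show ?thesis
  proof
    assume "eigenvalue ?Q x"
    then obtain w where w: "eigenvector ?Q w x" by (auto simp: eigenvalue_def)
    then have wn: "dim_vec w = ?n" by (auto simp: eigenvector_def dim)
    define f where "f v = w $ (the_inv_into {..<?n} ((!) vs) v)" for v
    have "f (vs ! i) = w $ i" if "i < ?n" for i
      using that assms(1) by (simp add: f_def the_inv_into_f_f inj_on_nth)
    then have "vec ?n (\<lambda>i. f (vs ! i)) = w"
      using wn by (intro eq_vecI) auto
    with w have "eigenvector ?Q (vec ?n (\<lambda>i. f (vs ! i))) x" by (simp only:)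
    then show "\<exists>f. ?nz f \<and> (\<forall>v \<in> pverts G. ?L f v = x * f v)"
      unfolding key by (rule exI[where x = f])
  next
    assume "\<exists>f. ?nz f \<and> (\<forall>v \<in> pverts G. ?L f v = x * f v)"
    then show "eigenvalue ?Q x" unfolding key[symmetric] eigenvalue_def by blast
  qed
qed

lemma eta_eq:
  assumes "distinct vs" "set vs = pverts G"
  shows "eta G = Max {x. eigenvalue (distance_signless_laplacian G vs) x}"
proof -
  have "distinct (vertex_list G) \<and> set (vertex_list G) = pverts G"
    unfolding vertex_list_def by (rule someI[where x = vs]) (use assms in simp)
  with assms show ?thesis
    by (simp add: eta_def eigenvalue_distance_signless_laplacian_iff)
qed

end

theory Submission
  imports Defs "HOL-Analysis.Function_Topology" "HOL-Combinatorics.Cycles" "HOL-Real_Asymp.Real_Asymp"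
begin

text \<open>
  A fixed-point-free permutation moving every vertex to a neighbour is the same thing as a factor
  into edges and (oriented) cycles, so by Hall's theorem a graph without a factor contains an
  independent set \<open>I\<close> with \<open>s + 1\<close> vertices and only \<open>s\<close> neighbours. It is then a spanning subgraph of
  \<open>H\<^sub>s = K\<^sub>s \<or> (K\<^sub>n\<^sub>-\<^sub>2\<^sub>s\<^sub>-\<^sub>1 + (s + 1) K\<^sub>1)\<close>; removing edges increases distances and hence, by the Rayleigh
  quotient and a Perron argument, strictly increases \<open>\<eta>\<close>. The two graphs of the statement are the
  extreme cases \<open>s = 1\<close> and \<open>s = (n - 1) div 2\<close>. Now \<open>\<eta>(H\<^sub>s) - 2n + 2\<close> is the largest root of a cubic whose
  value at a fixed point is convex in \<open>s\<close>, so for \<open>n \<ge> 17\<close> it suffices to evaluate the cubics of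
  the two ends of the range of \<open>s\<close> at the largest root for \<open>s = 1\<close>. For small \<open>n\<close> the
  values \<open>\<eta>(H\<^sub>s)\<close> are separated by explicit rational numbers.
\<close>

section \<open>Factors and deficient independent sets\<close>

text \<open>Hall's marriage theorem by the Halmos-Vaughan induction on \<open>card J\<close>: a
  nonempty proper subfamily whose union is no larger than its index set is represented first and its
  union is removed from the other sets; if there is none, any choice for one index leaves the
  condition intact.\<close>

lemma hall:
  fixes A :: "'i \<Rightarrow> 'b set"
  assumes "finite J" "\<And>i. i \<in> J \<Longrightarrow> finite (A i)"
    and "\<And>K. K \<subseteq> J \<Longrightarrow> card K \<le> card (\<Union>(A ` K))"
  shows "\<exists>R. inj_on R J \<and> (\<forall>i\<in>J. R i \<in> A i)"
  using assms
proof (induction "card J" arbitrary: J A rule: less_induct)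
  case less
  note fin = \<open>finite J\<close> and finA = less.prems(2) and hall = less.prems(3)
  have finU: "finite (\<Union>(A ` K))" if "K \<subseteq> J" for K
    using that fin finA by (auto intro: finite_subset)
  show ?case
  proof (cases "J = {}")
    case False
    show ?thesis
    proof (cases "\<exists>K. K \<subset> J \<and> K \<noteq> {} \<and> card (\<Union>(A ` K)) = card K")
      case True
      then obtain K where K: "K \<subset> J" "K \<noteq> {}" "card (\<Union>(A ` K)) = card K" by blast
      define U where "U = \<Union>(A ` K)"
      have finK: "finite K" using K(1) fin by (auto intro: finite_subset)
      have "\<exists>R. inj_on R K \<and> (\<forall>i\<in>K. R i \<in> A i)"
      proof (rule less.hyps[of K A])
        show "card K < card J" using K(1) fin by (rule psubset_card_mono[rotated])
      qed (use K finK finA hall in auto)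
      then obtain R1 where R1: "inj_on R1 K" "\<forall>i\<in>K. R1 i \<in> A i" by blast
      have "\<exists>R. inj_on R (J - K) \<and> (\<forall>i\<in>J - K. R i \<in> A i - U)"
      proof (rule less.hyps[of "J - K" "\<lambda>i. A i - U"])
        show "card (J - K) < card J" using K fin by (intro psubset_card_mono) auto
        fix L assume L: "L \<subseteq> J - K"
        \<comment> \<open>The tight family \<open>K\<close> accounts for only \<open>card K\<close>
          elements, so the condition for \<open>K \<union> L\<close> leaves at least
          \<open>card L\<close> outside \<open>U\<close>.\<close>
        have "card K + card L = card (K \<union> L)"
          using L finK fin by (subst card_Un_disjoint) (auto intro: finite_subset)
        also have "\<dots> \<le> card (\<Union>(A ` (K \<union> L)))" using L K by (intro hall) auto
        finally have "card L \<le> card (\<Union>(A ` (K \<union> L))) - card U"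
          using K(3) by (simp add: U_def)
        also have "\<dots> = card (\<Union>(A ` (K \<union> L)) - U)"
          using finU[of K] K(1) by (intro card_Diff_subset[symmetric]) (auto simp: U_def)
        also have "\<Union>(A ` (K \<union> L)) - U = \<Union>((\<lambda>i. A i - U) ` L)" by (auto simp: U_def)
        finally show "card L \<le> card (\<Union>((\<lambda>i. A i - U) ` L))" .
      qed (use fin finA in auto)
      then obtain R2 where R2: "inj_on R2 (J - K)" "\<forall>i\<in>J - K. R2 i \<in> A i - U" by blast
      define R where "R i = (if i \<in> K then R1 i else R2 i)" for i
      have "inj_on R (K \<union> (J - K))"
        unfolding inj_on_Un
      proof (intro conjI)
        show "inj_on R K" using R1(1) by (simp add: R_def inj_on_def)
        show "inj_on R (J - K)" using R2(1) by (simp add: R_def inj_on_def)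
        show "R ` (K - (J - K)) \<inter> R ` (J - K - K) = {}"
          using R1(2) R2(2) by (auto simp: R_def U_def)
      qed
      moreover have "K \<union> (J - K) = J" using K(1) by auto
      ultimately show ?thesis using R1(2) R2(2) by (intro exI[of _ R]) (auto simp: R_def)
    next
      case tight: False
      obtain i where i: "i \<in> J" using False by auto
      have "card {i} \<le> card (\<Union>(A ` {i}))" using i by (intro hall) auto
      then obtain x where x: "x \<in> A i" by fastforce
      have "\<exists>R. inj_on R (J - {i}) \<and> (\<forall>j\<in>J - {i}. R j \<in> A j - {x})"
      proof (rule less.hyps[of "J - {i}" "\<lambda>j. A j - {x}"])
        show "card (J - {i}) < card J" using i fin by (intro psubset_card_mono) auto
        fix K assume K: "K \<subseteq> J - {i}"
        show "card K \<le> card (\<Union>((\<lambda>j. A j - {x}) ` K))"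
        proof (cases "K = {}")
          case False
          \<comment> \<open>Without a tight subfamily there is a surplus of one, which pays for the
            removal of \<open>x\<close>.\<close>
          have "K \<subset> J" using K i by auto
          then have "card K \<noteq> card (\<Union>(A ` K))" using tight False by metis
          moreover have "card K \<le> card (\<Union>(A ` K))" using K by (intro hall) auto
          ultimately have "card K \<le> card (\<Union>(A ` K)) - 1" by simp
          also have "\<dots> \<le> card (\<Union>(A ` K) - {x})"
            using diff_card_le_card_Diff[of "{x}" "\<Union>(A ` K)"] by simp
          also have "\<Union>(A ` K) - {x} = \<Union>((\<lambda>j. A j - {x}) ` K)" by auto
          finally show ?thesis .
        qed simp
      qed (use fin finA in auto)
      then obtain R where R: "inj_on R (J - {i})" "\<forall>j\<in>J - {i}. R j \<in> A j - {x}" by blast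
      have "inj_on (R(i := x)) (insert i (J - {i}))"
        using R by (subst inj_on_insert) (auto simp: inj_on_def)
      then show ?thesis using R x i
        by (intro exI[of _ "R(i := x)"]) (auto simp: insert_absorb)
    qed
  qed simp
qed

section \<open>Permutations without fixed points as factors\<close>

lemma graph_isoI:
  assumes "pair_wf_digraph H" "inj_on f (pverts H)"
    and "pverts K = f ` pverts H" "parcs K = map_prod f f ` parcs H"
  shows "graph_iso H K"
proof -
  define h where "h = \<lparr> iso_verts = f, iso_arcs = map_prod f f, iso_head = snd, iso_tail = fst \<rparr>"
  interpret pair_wf_digraph H by fact
  \<comment> \<open>Arcs are pairs of vertices, so injectivity on vertices carries over to the
    induced arc map.\<close>
  have "inj_on (map_prod f f) (parcs H)"
    using assms(2) wellformed' unfolding inj_on_def by (auto simp: map_prod_def split: prod.splits)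
  then have "pre_digraph.digraph_isomorphism (with_proj H) h"
    using assms(2) wf_digraph_axioms by (auto simp: pre_digraph.digraph_isomorphism_def h_def)
  moreover have "with_proj K = app_iso h (with_proj H)"
    using assms(3,4) by (simp add: app_iso_def h_def with_proj_def)
  ultimately show ?thesis unfolding graph_iso_def digraph_iso_def by blast
qed

lemma pair_graph_imp_wf: "pair_graph H \<Longrightarrow> pair_wf_digraph H"
  by (simp add: pair_graph_def pair_digraph_def pair_fin_digraph_def)

text \<open>Both orientations of each step are arcs, so a cycle of length 2 of \<open>p\<close>
  becomes a single edge and a longer one an undirected cycle.\<close>

definition cycle_cover :: "'a set \<Rightarrow> ('a \<Rightarrow> 'a) \<Rightarrow> 'a pair_pre_digraph" where
  "cycle_cover V p = \<lparr> pverts = V, parcs = {(u, v). u \<in> V \<and> v \<in> V \<and> (v = p u \<or> u = p v)} \<rparr>"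

locale fixpoint_free_permutation =
  fixes V :: "'a set" and p :: "'a \<Rightarrow> 'a"
  assumes fin: "finite V" and perm: "p permutes V" and no_fix: "\<And>v. v \<in> V \<Longrightarrow> p v \<noteq> v"
begin

abbreviation "F \<equiv> cycle_cover V p"

lemma pair_graph_F: "pair_graph F"
  using fin no_fix by (auto simp: pair_graph_iff cycle_cover_def sym_def irrefl_def) metis

sublocale pair_graph F by (rule pair_graph_F)

lemma in_V: "v \<in> V \<Longrightarrow> (p ^^ i) v \<in> V"
  by (induction i) (auto simp: permutes_in_image[OF perm])

lemma permutation: "permutation p"
  using fin perm by (auto simp: permutation_permutes)

lemma reachable_iff:
  assumes "v \<in> V"
  shows "v \<rightarrow>\<^sup>*\<^bsub>with_proj F\<^esub> w \<longleftrightarrow> (\<exists>i. w = (p ^^ i) v)"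
proof
  assume "v \<rightarrow>\<^sup>*\<^bsub>with_proj F\<^esub> w"
  then show "\<exists>i. w = (p ^^ i) v"
  proof (induction rule: reachable_induct)
    case base
    show ?case by (rule exI[of _ 0]) simp
  next
    case (step x y)
    then obtain i where i: "x = (p ^^ i) v" by blast
    from step(2) consider "y = p x" | "x = p y" by (auto simp: cycle_cover_def)
    then show ?case
    proof cases
      case 1
      then show ?thesis using i by (intro exI[of _ "Suc i"]) simp
    next
      case 2
      \<comment> \<open>An arc traversed against \<open>p\<close> is replaced by going forward
        around the rest of the finite orbit of \<open>y\<close>.\<close>
      have "y = (p ^^ (Suc (least_power p y - 1))) y"
        using least_power_of_permutation[OF permutation, of y] by simp
      also have "\<dots> = (p ^^ (least_power p y - 1)) x"
        by (simp add: funpow_Suc_right 2 del: funpow.simps)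
      also have "\<dots> = (p ^^ (least_power p y - 1 + i)) v"
        by (simp add: i funpow_add)
      finally show ?thesis by blast
    qed
  qed
next
  assume "\<exists>i. w = (p ^^ i) v"
  then obtain i where "w = (p ^^ i) v" by blast
  moreover have "v \<rightarrow>\<^sup>*\<^bsub>with_proj F\<^esub> (p ^^ i) v"
  proof (induction i)
    case 0
    have "v \<in> pverts F" using assms by (simp add: cycle_cover_def)
    then show ?case by simp
  next
    case (Suc i)
    have "((p ^^ i) v, (p ^^ Suc i) v) \<in> parcs F"
      using in_V[OF assms, of i] in_V[OF assms, of "Suc i"] by (simp add: cycle_cover_def)
    with Suc show ?case by (rule reachable_adj_trans)
  qed
  ultimately show "v \<rightarrow>\<^sup>*\<^bsub>with_proj F\<^esub> w" by simp
qed

text \<open>The component of \<open>v\<close> is its orbit under \<open>p\<close>, listed by the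
  powers of \<open>p\<close> below the orbit length \<open>k\<close>; the case \<open>k = 2\<close>
  stands for \<open>K\<^sub>2\<close>.\<close>

lemma scc_iso_cycle:
  assumes "C \<in> pre_digraph.sccs (with_proj F)"
  obtains k where "k \<ge> 2" "digraph_iso C (with_proj (cycle_graph k))"
proof -
  obtain T where T: "T \<in> pre_digraph.sccs_verts (with_proj F)" and C: "C = with_proj F \<restriction> T"
    using assms by (auto simp: sccs_conv_sccs_verts)
  then obtain v where v: "v \<in> T" by (auto simp: pre_digraph.sccs_verts_def)
  have "v \<rightarrow>\<^sup>*\<^bsub>with_proj F\<^esub> v" using T v by (auto simp: pre_digraph.sccs_verts_def)
  then have vV: "v \<in> V" using reachable_in_verts[of v v] by (simp add: cycle_cover_def)
  define k where "k = least_power p v"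
  define f where "f = (\<lambda>i. (p ^^ i) v)"
  have k: "k > 0" "f k = v"
    using least_power_of_permutation[OF permutation, of v] by (auto simp: k_def f_def)
  have fS: "f (Suc i) = p (f i)" for i by (simp add: f_def)
  have fV: "f i \<in> V" for i using in_V[OF vV] by (simp add: f_def)
  have "k \<noteq> 1" using k no_fix[OF vV] by (auto simp: f_def)
  with k have k2: "k \<ge> 2" by simp
  have inj: "inj_on f {..<k}"
    using cycle_of_permutation[OF permutation, of v]
    by (simp add: distinct_map f_def k_def lessThan_atLeast0)
  have img: "f ` {..<k} = range f"
    using support_set[OF permutation, of v] by (simp add: f_def k_def lessThan_atLeast0)
  have T_eq: "T = f ` {..<k}"
    unfolding img
  proof
    show "T \<subseteq> range f"
    proof
      fix w assume "w \<in> T"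
      then have "v \<rightarrow>\<^sup>*\<^bsub>with_proj F\<^esub> w" using T v by (auto simp: pre_digraph.sccs_verts_def)
      then show "w \<in> range f" by (auto simp: reachable_iff[OF vV] f_def)
    qed
    show "range f \<subseteq> T"
    proof
      fix w assume "w \<in> range f"
      then have "v \<rightarrow>\<^sup>*\<^bsub>with_proj F\<^esub> w" using reachable_iff[OF vV] by (auto simp: f_def)
      moreover from this have "w \<rightarrow>\<^sup>*\<^bsub>with_proj F\<^esub> v" by (rule symmetric_reachable[OF sym_arcs])
      ultimately show "w \<in> T" using T v by (auto simp: pre_digraph.sccs_verts_def)
    qed
  qed
  \<comment> \<open>The index wraps around because \<open>f k = v = f 0\<close>.\<close>
  have f_mod: "f (Suc i mod k) = p (f i)" if "i < k" for i
    using that k fS[of i] by (cases "Suc i = k") (auto simp: f_def)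
  have step_iff: "f j = p (f i) \<longleftrightarrow> j = Suc i mod k" if "i < k" "j < k" for i j
    using inj_on_eq_iff[OF inj, of j "Suc i mod k"] that f_mod[OF that(1)] k(1) by simp
  have "with_proj \<lparr> pverts = T, parcs = {(x, y) \<in> parcs F. x \<in> T \<and> y \<in> T} \<rparr> = C"
    by (auto simp: C induce_subgraph_def with_proj_def)
  moreover have "graph_iso (cycle_graph k) \<lparr> pverts = T, parcs = {(x, y) \<in> parcs F. x \<in> T \<and> y \<in> T} \<rparr>"
  proof (rule graph_isoI)
    show "pair_wf_digraph (cycle_graph k)"
      using pair_graph_cycle_graph[OF k2] by (rule pair_graph_imp_wf)
    show "inj_on f (pverts (cycle_graph k))" using inj by (simp add: cycle_graph_def)
    show "pverts \<lparr>pverts = T, parcs = {(x, y) \<in> parcs F. x \<in> T \<and> y \<in> T}\<rparr> = f ` pverts (cycle_graph k)"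
      using T_eq by (simp add: cycle_graph_def)
    show "parcs \<lparr>pverts = T, parcs = {(x, y) \<in> parcs F. x \<in> T \<and> y \<in> T}\<rparr> =
        map_prod f f ` parcs (cycle_graph k)"
    proof -
      have edge: "(f i, f j) \<in> parcs F \<longleftrightarrow> j = Suc i mod k \<or> i = Suc j mod k" if "i < k" "j < k" for i j
        using fV step_iff[OF that] step_iff[OF that(2,1)] by (simp add: cycle_cover_def)
      have "{(x, y) \<in> parcs F. x \<in> T \<and> y \<in> T} =
          {(f i, f j) | i j. i < k \<and> j < k \<and> (f i, f j) \<in> parcs F}"
        unfolding T_eq by auto
      also have "\<dots> = {(f i, f j) | i j. i < k \<and> j < k \<and> (j = Suc i mod k \<or> i = Suc j mod k)}"
        using edge by blast
      also have "\<dots> = map_prod f f ` parcs (cycle_graph k)"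
        unfolding cycle_graph_def by force
      finally show ?thesis by simp
    qed
  qed
  ultimately have "digraph_iso (with_proj (cycle_graph k)) C" by (simp add: graph_iso_def)
  then have "digraph_iso C (with_proj (cycle_graph k))"
    using pair_graph_imp_wf[OF pair_graph_cycle_graph[OF k2]]
    by (intro digraph_iso_swap[of "with_proj (cycle_graph k)" C]) (simp_all only: wf_digraph_wp_iff)
  then show thesis using k2 that by blast
qed

end

lemma cycle_graph_2: "cycle_graph 2 = complete_graph 2"
proof -
  have "i < 2 \<and> j < 2 \<and> (j = Suc i mod 2 \<or> i = Suc j mod 2) \<longleftrightarrow> i < 2 \<and> j < 2 \<and> i \<noteq> j" for i j :: nat
    by (cases "i < 2"; cases "j < 2") (auto dest!: less_2_cases)
  then show ?thesis by (simp only: cycle_graph_def complete_graph_def)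
qed

text \<open>Every orbit of \<open>p\<close> spans an edge or a cycle of \<open>G\<close>; fixed
  points are excluded since \<open>G\<close> has no loops.\<close>

lemma factor_of_permutation:
  assumes G: "pair_graph G" and p: "p permutes pverts G" "\<And>v. v \<in> pverts G \<Longrightarrow> (v, p v) \<in> parcs G"
  shows "has_K2_Ck_factor G"
proof -
  interpret G: pair_graph G by fact
  have nofix: "p v \<noteq> v" if "v \<in> pverts G" for v
    using G.pair_no_loops[OF p(2)[OF that]] by simp
  interpret fixpoint_free_permutation "pverts G" p
    using p(1) nofix by unfold_locales auto
  have "parcs F \<subseteq> parcs G"
    using p(2) G.pair_sym_arcs by (auto simp: cycle_cover_def symmetric_def dest: symD)
  then have "spanning (with_proj F) (with_proj G)"
    using wf_digraph_axioms G.wf_digraph_axioms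
    by (auto simp: spanning_def subgraph_def compatible_def cycle_cover_def)
  moreover have "digraph_iso C (with_proj (complete_graph 2)) \<or>
      (\<exists>k\<ge>3. digraph_iso C (with_proj (cycle_graph k)))"
    if C: "C \<in> pre_digraph.sccs (with_proj F)" for C
  proof -
    obtain k where "k \<ge> 2" "digraph_iso C (with_proj (cycle_graph k))"
      using scc_iso_cycle[OF C] .
    then show ?thesis
      using cycle_graph_2 by (cases "k = 2") (auto simp: numeral_3_eq_3 intro!: exI[of _ k])
  qed
  ultimately show ?thesis
    using pair_graph_F unfolding has_K2_Ck_factor_def is_K2_Ck_factor_def by blast
qed

text \<open>A set \<open>X\<close> with \<open>|N(X)| < |X|\<close> yields the independent set \<open>X - N(X)\<close>, whose
  neighbourhood is contained in \<open>N(X) - X\<close>.\<close>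

lemma no_factor_deficiency:
  assumes G: "pair_graph G" and no: "\<not> has_K2_Ck_factor G"
  obtains S I where "S \<subseteq> pverts G" "I \<subseteq> pverts G" "S \<inter> I = {}" "card I = Suc (card S)"
    "\<And>u w. u \<in> I \<Longrightarrow> (u, w) \<in> parcs G \<Longrightarrow> w \<in> S"
proof -
  interpret G: pair_graph G by fact
  let ?V = "pverts G"
  define N where "N u = {w. (u, w) \<in> parcs G}" for u
  have N_sub: "N u \<subseteq> ?V" for u using G.wellformed' by (auto simp: N_def)
  have N_sym: "w \<in> N u \<longleftrightarrow> u \<in> N w" for u w
    using G.pair_sym_arcs by (auto simp: N_def symmetric_def dest: symD)
  have finN: "finite (N u)" for u by (rule finite_subset[OF N_sub G.pair_finite_verts])
  \<comment> \<open>An injective choice of neighbours maps the finite vertex set onto itself, so it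
    would be a permutation yielding a factor.\<close>
  have "\<not> (\<exists>R. inj_on R ?V \<and> (\<forall>i\<in>?V. R i \<in> N i))"
  proof
    assume "\<exists>R. inj_on R ?V \<and> (\<forall>i\<in>?V. R i \<in> N i)"
    then obtain R where R: "inj_on R ?V" "\<forall>i\<in>?V. R i \<in> N i" by blast
    have "R ` ?V = ?V"
      using R N_sub by (intro endo_inj_surj) auto
    then have bij: "bij_betw R ?V ?V" using R(1) by (simp add: bij_betw_def)
    define p where "p v = (if v \<in> ?V then R v else v)" for v
    have "bij_betw p ?V ?V" using bij by (simp add: p_def cong: bij_betw_cong)
    then have "p permutes ?V" by (rule bij_imp_permutes) (simp add: p_def)
    then have "has_K2_Ck_factor G"
      using factor_of_permutation[OF G, of p] R(2) by (simp add: p_def N_def)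
    with no show False by simp
  qed
  then obtain X where X: "X \<subseteq> ?V" "card (\<Union>(N ` X)) < card X"
    using hall[of ?V N] finN G.pair_finite_verts by (meson not_less)
  let ?NX = "\<Union>(N ` X)"
  define Y where "Y = X - ?NX"
  define S where "S = \<Union>(N ` Y)"
  have finX: "finite X" by (rule finite_subset[OF X(1) G.pair_finite_verts])
  have finNX: "finite ?NX" using finX finN by auto
  \<comment> \<open>A neighbour of a vertex \<open>y\<close> of \<open>Y\<close> lying in
    \<open>X\<close> would put \<open>y\<close> into \<open>?NX\<close>, by symmetry of
    adjacency.\<close>
  have S_sub: "S \<subseteq> ?NX - X"
    unfolding S_def Y_def using N_sym by blast
  \<comment> \<open>Counting: |N(X) - X| = |N(X)| - |N(X) \<inter> X| < |X| - |N(X) \<inter> X| =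
    |Y|.\<close>
  have "card S \<le> card (?NX - X)" using S_sub finNX by (intro card_mono) auto
  also have "\<dots> = card ?NX - card (?NX \<inter> X)"
    using finNX by (subst card_Diff_subset_Int) (auto simp: Int_commute)
  also have "\<dots> < card X - card (X \<inter> ?NX)"
  proof -
    have "card (?NX \<inter> X) \<le> card ?NX" using finNX by (intro card_mono) auto
    then show ?thesis using X(2) by (simp add: Int_commute)
  qed
  also have "\<dots> = card Y" unfolding Y_def using finX by (subst card_Diff_subset_Int) auto
  finally have "Suc (card S) \<le> card Y" by simp
  \<comment> \<open>Trimming \<open>Y\<close> makes the excess exactly one; the neighbours of
    \<open>I\<close> still lie in \<open>S\<close>.\<close>
  then obtain I where I: "I \<subseteq> Y" "card I = Suc (card S)"
    using obtain_subset_with_card_n by metis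
  show thesis
  proof (rule that)
    show "S \<subseteq> ?V" using S_sub N_sub by blast
    show "I \<subseteq> ?V" using I X by (auto simp: Y_def)
    show "S \<inter> I = {}" using I S_sub by (auto simp: Y_def)
    show "card I = Suc (card S)" by (rule I)
    show "w \<in> S" if "u \<in> I" "(u, w) \<in> parcs G" for u w
      using that I by (auto simp: S_def N_def)
  qed
qed

section \<open>Largest eigenvalues and Rayleigh quotients\<close>

text \<open>For \<open>d\<close> the distance of a graph this is the value of
  \<open>(Tr + D) f\<close> at \<open>v\<close>; the transmission contributes the multiples of
  \<open>f v\<close>.\<close>

definition signless_form :: "'a set \<Rightarrow> ('a \<Rightarrow> 'a \<Rightarrow> real) \<Rightarrow> ('a \<Rightarrow> real) \<Rightarrow> 'a \<Rightarrow> real" where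
  "signless_form V d f v = (\<Sum>u\<in>V. d v u * (f v + f u))"

definition eigenfunction :: "'a set \<Rightarrow> ('a \<Rightarrow> 'a \<Rightarrow> real) \<Rightarrow> real \<Rightarrow> ('a \<Rightarrow> real) \<Rightarrow> bool" where
  "eigenfunction V d x f \<longleftrightarrow> (\<exists>v\<in>V. f v \<noteq> 0) \<and> (\<forall>v\<in>V. signless_form V d f v = x * f v)"

definition top_eigenvalue :: "'a set \<Rightarrow> ('a \<Rightarrow> 'a \<Rightarrow> real) \<Rightarrow> real \<Rightarrow> bool" where
  "top_eigenvalue V d x \<longleftrightarrow> (\<exists>f. eigenfunction V d x f) \<and> (\<forall>y f. eigenfunction V d y f \<longrightarrow> y \<le> x)"

text \<open>The double sum is averaged with its transposed copy. Keeping \<open>g\<close> and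
  \<open>f\<close> apart gives the self-adjointness of the form at once.\<close>

lemma quadratic_form:
  assumes "\<And>u v. u \<in> V \<Longrightarrow> v \<in> V \<Longrightarrow> d u v = d v u"
  shows "(\<Sum>v\<in>V. g v * signless_form V d f v) = (\<Sum>v\<in>V. \<Sum>u\<in>V. d v u * ((g v + g u) * (f v + f u))) / 2"
proof -
  have "(\<Sum>v\<in>V. g v * signless_form V d f v) = (\<Sum>v\<in>V. \<Sum>u\<in>V. d v u * (g v * (f v + f u)))" (is "?L = ?S1")
    unfolding signless_form_def sum_distrib_left by (intro sum.cong) (auto simp: algebra_simps)
  moreover have "?S1 = (\<Sum>u\<in>V. \<Sum>v\<in>V. d v u * (g v * (f v + f u)))"
    by (rule sum.swap)
  moreover have "\<dots> = (\<Sum>u\<in>V. \<Sum>v\<in>V. d u v * (g v * (f u + f v)))"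
    by (intro sum.cong refl) (simp add: assms add.commute)
  moreover have "?S1 + (\<Sum>u\<in>V. \<Sum>v\<in>V. d u v * (g v * (f u + f v))) =
      (\<Sum>v\<in>V. \<Sum>u\<in>V. d v u * ((g v + g u) * (f v + f u)))"
    unfolding sum.distrib[symmetric] by (intro sum.cong refl) (simp add: algebra_simps)
  ultimately show ?thesis by simp
qed

lemma signless_form_symmetric:
  assumes "\<And>u v. u \<in> V \<Longrightarrow> v \<in> V \<Longrightarrow> d u v = d v u"
  shows "(\<Sum>v\<in>V. g v * signless_form V d f v) = (\<Sum>v\<in>V. f v * signless_form V d g v)"
  by (subst (1 2) quadratic_form[of V d, OF assms]) (simp_all add: mult.commute)

lemma linear_term_zero:
  fixes b c :: real
  assumes "\<And>t. 0 \<le> 2 * t * b + t\<^sup>2 * c" "c \<ge> 0"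
  shows "b = 0"
proof (rule ccontr)
  assume "b \<noteq> 0"
  \<comment> \<open>A step against the sign of \<open>b\<close>; dividing by \<open>c + 1\<close>
    rather than \<open>c\<close> also covers \<open>c = 0\<close>.\<close>
  have "0 \<le> 2 * (- b / (c + 1)) * b + (- b / (c + 1))\<^sup>2 * c" by (rule assms)
  also have "\<dots> = - (b\<^sup>2 * (c + 2)) / (c + 1)\<^sup>2"
    using assms(2) by (simp add: power2_eq_square divide_simps) (simp add: algebra_simps)
  also have "\<dots> < 0"
    using \<open>b \<noteq> 0\<close> assms(2) by (intro divide_neg_pos) auto
  finally show False by simp
qed

text \<open>First variation: \<open>x\<close> times the squared norm minus the quadratic form is
  nonnegative and vanishes at \<open>f\<close>, so its linear term in the direction of the indicator
  of \<open>w\<close> is zero, which is the eigenvalue equation at \<open>w\<close>.\<close>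

lemma maximizer_is_eigen:
  assumes fin: "finite V"
    and sym: "\<And>u v. u \<in> V \<Longrightarrow> v \<in> V \<Longrightarrow> d u v = d v u"
    and bound: "\<And>g. (\<Sum>v\<in>V. g v * signless_form V d g v) \<le> x * (\<Sum>v\<in>V. (g v)\<^sup>2)"
    and max: "(\<Sum>v\<in>V. f v * signless_form V d f v) = x * (\<Sum>v\<in>V. (f v)\<^sup>2)"
    and "w \<in> V"
  shows "signless_form V d f w = x * f w"
proof -
  define h where "h = (\<lambda>v. if v = w then 1 else 0 :: real)"
  define P where "P g = (\<Sum>v\<in>V. g v * (x * g v - signless_form V d g v))" for g
  have P: "P g = x * (\<Sum>v\<in>V. (g v)\<^sup>2) - (\<Sum>v\<in>V. g v * signless_form V d g v)" for g
    unfolding P_def by (simp add: algebra_simps sum_subtractf sum_distrib_left power2_eq_square)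
  have pos: "P g \<ge> 0" for g using bound[of g] P[of g] by simp
  define B where "B = (\<Sum>v\<in>V. h v * (x * f v - signless_form V d f v))"
  \<comment> \<open>Self-adjointness makes the two cross terms of the expansion equal.\<close>
  have B: "B = (\<Sum>v\<in>V. f v * (x * h v - signless_form V d h v))"
    unfolding B_def using signless_form_symmetric[of V d h f, OF sym]
    by (simp add: algebra_simps sum_subtractf)
  have lin: "signless_form V d (\<lambda>v. f v + t * h v) v = signless_form V d f v + t * signless_form V d h v" for t v
    unfolding signless_form_def sum_distrib_left sum.distrib[symmetric]
    by (intro sum.cong) (auto simp: algebra_simps)
  have "P (\<lambda>v. f v + t * h v) = P f + (t * B + t * (\<Sum>v\<in>V. f v * (x * h v - signless_form V d h v))) + t\<^sup>2 * P h" for t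
    unfolding P_def B_def lin sum_distrib_left sum.distrib[symmetric]
    by (intro sum.cong refl) (simp add: algebra_simps power2_eq_square)
  moreover have "P f = 0" using P[of f] max by simp
  ultimately have "P (\<lambda>v. f v + t * h v) = 2 * t * B + t\<^sup>2 * P h" for t
    using B by simp
  with pos have "\<And>t. 0 \<le> 2 * t * B + t\<^sup>2 * P h" by metis
  then have "B = 0" by (rule linear_term_zero) (rule pos)
  moreover have "B = x * f w - signless_form V d f w"
  proof -
    have "B = (\<Sum>v\<in>V. if v = w then x * f v - signless_form V d f v else 0)"
      unfolding B_def h_def by (intro sum.cong) auto
    then show ?thesis using fin \<open>w \<in> V\<close> by simp
  qed
  ultimately show ?thesis by simp
qed

text \<open>Compactness of the unit sphere gives a maximizer; since the form is homogeneous of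
  degree two, the bound extends to every \<open>g\<close>.\<close>

lemma rayleigh_maximum_attained:
  fixes d :: "'a \<Rightarrow> 'a \<Rightarrow> real"
  assumes fin: "finite V" and "V \<noteq> {}"
  obtains x f where "(\<Sum>v\<in>V. (f v)\<^sup>2) = 1" "(\<Sum>v\<in>V. f v * signless_form V d f v) = x"
    "\<And>g. (\<Sum>v\<in>V. g v * signless_form V d g v) \<le> x * (\<Sum>v\<in>V. (g v)\<^sup>2)"
proof -
  define q where "q f = (\<Sum>v\<in>V. f v * signless_form V d f v)" for f
  define N where "N f = (\<Sum>v\<in>V. (f v)\<^sup>2)" for f :: "'a \<Rightarrow> real"
  \<comment> \<open>Functions live on the whole type, so they are pinned to 0 outside
    \<open>V\<close>; the box is then a product of compact sets.\<close>
  define box where "box = (PiE UNIV (\<lambda>v. if v \<in> V then {-1..1} else {0}) :: ('a \<Rightarrow> real) set)"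
  define K where "K = box \<inter> {f. N f = 1}"
  have cont: "continuous_on UNIV (\<lambda>f :: 'a \<Rightarrow> real. f v)" for v
    by (rule continuous_on_product_coordinates)
  have contN: "continuous_on UNIV N"
    unfolding N_def by (intro continuous_intros continuous_on_subset[OF cont]) auto
  have contq: "continuous_on UNIV q"
    unfolding q_def signless_form_def by (intro continuous_intros continuous_on_subset[OF cont]) auto
  have "compactin (product_topology (\<lambda>_. euclidean) UNIV) box"
    unfolding box_def by (subst compactin_PiE) auto
  then have "compact box" by (simp add: euclidean_product_topology)
  moreover have "closed {f. N f = 1}"
    by (intro closed_Collect_eq contN continuous_intros)
  ultimately have "compact K" unfolding K_def by (rule compact_Int_closed)
  moreover have inK: "(\<lambda>v. if v \<in> V then f v / sqrt (N f) else 0) \<in> K"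
    if "N f > 0" for f
  proof -
    have "\<bar>f v\<bar> \<le> sqrt (N f)" if "v \<in> V" for v
      using that fin unfolding N_def
      by (intro real_le_rsqrt) (auto intro!: member_le_sum[of v V "\<lambda>v. (f v)\<^sup>2"])
    then have "f v / sqrt (N f) \<in> {-1..1}" if "v \<in> V" for v
      using that \<open>N f > 0\<close> by (fastforce simp: abs_le_iff field_simps)
    moreover have "(\<Sum>v\<in>V. (f v / sqrt (N f))\<^sup>2) = 1"
      using that unfolding N_def by (simp add: power_divide sum_divide_distrib[symmetric])
    ultimately show ?thesis
        unfolding K_def box_def N_def by (auto simp: PiE_UNIV_domain)
  qed
  moreover have "K \<noteq> {}"
  proof -
    have "N (\<lambda>_. 1) > 0" using assms by (simp add: N_def card_gt_0_iff)
    from inK[OF this] show ?thesis by auto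
  qed
  ultimately obtain f where f: "f \<in> K" "\<And>g. g \<in> K \<Longrightarrow> q g \<le> q f"
    using continuous_attains_sup[of K q] contq continuous_on_subset by blast
  have "q g \<le> q f * N g" for g
  proof (cases "N g > 0")
    case True
    have "q (\<lambda>v. if v \<in> V then g v / sqrt (N g) else 0) = q g / N g"
    proof -
      have "signless_form V d (\<lambda>v. if v \<in> V then g v / sqrt (N g) else 0) v = signless_form V d g v / sqrt (N g)"
        if "v \<in> V" for v
        unfolding signless_form_def sum_divide_distrib
        using that by (intro sum.cong) (auto simp: algebra_simps add_divide_distrib)
      then have "q (\<lambda>v. if v \<in> V then g v / sqrt (N g) else 0) =
        (\<Sum>v\<in>V. (g v * signless_form V d g v) / (sqrt (N g) * sqrt (N g)))"
        unfolding q_def by (intro sum.cong) auto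
      then show ?thesis using True by (simp add: q_def sum_divide_distrib[symmetric])
    qed
    then show ?thesis using f(2)[OF inK[OF True]] True by (simp add: pos_divide_le_eq)
  next
    case False
    then have "\<forall>v\<in>V. (g v)\<^sup>2 = 0"
      using fin sum_nonneg_eq_0_iff[of V "\<lambda>v. (g v)\<^sup>2"] sum_nonneg[of V "\<lambda>v. (g v)\<^sup>2"]
      unfolding N_def by force
    then show ?thesis by (simp add: q_def N_def)
  qed
  moreover have "N f = 1" using f(1) by (simp add: K_def)
  ultimately show thesis using that[of f "q f"] unfolding q_def N_def by blast
qed

lemma eigenfunction_rayleigh:
  assumes "eigenfunction V d x f"
  shows "(\<Sum>v\<in>V. f v * signless_form V d f v) = x * (\<Sum>v\<in>V. (f v)\<^sup>2)"
  using assms unfolding eigenfunction_def sum_distrib_left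
  by (intro sum.cong) (auto simp: power2_eq_square)

lemma sum_squares_pos:
  fixes f :: "'a \<Rightarrow> real"
  assumes "finite V" "\<exists>v\<in>V. f v \<noteq> 0"
  shows "(\<Sum>v\<in>V. (f v)\<^sup>2) > 0"
  using assms by (auto intro!: sum_pos2)

text \<open>The maximal Rayleigh quotient is an eigenvalue by first variation, and any eigenvalue is
  the quotient of its own eigenfunction.\<close>

lemma top_eigenvalue_exists:
  assumes "finite V" "V \<noteq> {}"
    and sym: "\<And>u v. u \<in> V \<Longrightarrow> v \<in> V \<Longrightarrow> d u v = d v u"
  obtains x where "top_eigenvalue V d x"
    "\<And>g. (\<Sum>v\<in>V. g v * signless_form V d g v) \<le> x * (\<Sum>v\<in>V. (g v)\<^sup>2)"
proof -
  obtain x f where f: "(\<Sum>v\<in>V. (f v)\<^sup>2) = 1" "(\<Sum>v\<in>V. f v * signless_form V d f v) = x"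
    and b: "\<And>g. (\<Sum>v\<in>V. g v * signless_form V d g v) \<le> x * (\<Sum>v\<in>V. (g v)\<^sup>2)"
    using rayleigh_maximum_attained[OF assms(1,2), of d] by metis
  have "eigenfunction V d x f"
  proof -
    have "\<exists>v\<in>V. f v \<noteq> 0" by (rule ccontr) (use f in auto)
    moreover have "\<forall>v\<in>V. signless_form V d f v = x * f v"
      using maximizer_is_eigen[OF assms(1) sym b] f by auto
    ultimately show ?thesis by (simp add: eigenfunction_def)
  qed
  moreover have "y \<le> x" if "eigenfunction V d y g" for y g
  proof -
    have "y * (\<Sum>v\<in>V. (g v)\<^sup>2) \<le> x * (\<Sum>v\<in>V. (g v)\<^sup>2)"
      using b[of g] eigenfunction_rayleigh[OF that] by simp
    moreover have "(\<Sum>v\<in>V. (g v)\<^sup>2) > 0"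
      using that sum_squares_pos[OF assms(1)] by (auto simp: eigenfunction_def)
    ultimately show ?thesis by simp
  qed
  ultimately have "top_eigenvalue V d x" unfolding top_eigenvalue_def by blast
  then show thesis using b by (rule that)
qed

lemma top_eigenvalue_unique:
  "top_eigenvalue V d x \<Longrightarrow> top_eigenvalue V d y \<Longrightarrow> x = y"
  unfolding top_eigenvalue_def by (meson order_antisym)

lemma top_eigenvalue_rayleigh:
  assumes "finite V" "\<And>u v. u \<in> V \<Longrightarrow> v \<in> V \<Longrightarrow> d u v = d v u"
    and "top_eigenvalue V d x"
  shows "(\<Sum>v\<in>V. g v * signless_form V d g v) \<le> x * (\<Sum>v\<in>V. (g v)\<^sup>2)"
proof -
  have "V \<noteq> {}" using assms(3) by (auto simp: top_eigenvalue_def eigenfunction_def)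
  then show ?thesis
    using top_eigenvalue_exists[of V d] top_eigenvalue_unique[OF assms(3)] assms(1,2) by metis
qed

text \<open>Perron's argument: the modulus of an eigenfunction for the largest eigenvalue again attains
  the maximal Rayleigh quotient.\<close>

lemma top_eigenvalue_positive_eigenfunction:
  assumes fin: "finite V"
    and sym: "\<And>u v. u \<in> V \<Longrightarrow> v \<in> V \<Longrightarrow> d u v = d v u"
    and pos: "\<And>u v. u \<in> V \<Longrightarrow> v \<in> V \<Longrightarrow> u \<noteq> v \<Longrightarrow> d u v > 0"
    and nonneg: "\<And>u. u \<in> V \<Longrightarrow> d u u \<ge> 0"
    and top: "top_eigenvalue V d x"
  shows "\<exists>f. eigenfunction V d x f \<and> (\<forall>v\<in>V. f v > 0)"
proof -
  obtain g where g: "eigenfunction V d x g" using top by (auto simp: top_eigenvalue_def)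
  define f where "f v = \<bar>g v\<bar>" for v
  note bound = top_eigenvalue_rayleigh[OF fin sym top]
  have d0: "d u v \<ge> 0" if "u \<in> V" "v \<in> V" for u v
    using pos[OF that] nonneg that by (cases "u = v") (auto intro: less_imp_le)
  have "(\<Sum>v\<in>V. f v * signless_form V d f v) \<ge> (\<Sum>v\<in>V. g v * signless_form V d g v)"
    unfolding signless_form_def sum_distrib_left
  proof (intro sum_mono)
    fix v u assume vu: "v \<in> V" "u \<in> V"
    have "g v * (g v + g u) \<le> f v * (f v + f u)"
      using abs_ge_self[of "g v * g u"] by (simp add: f_def algebra_simps abs_mult)
    then have "d v u * (g v * (g v + g u)) \<le> d v u * (f v * (f v + f u))"
      using d0[OF vu] by (rule mult_left_mono)
    then show "g v * (d v u * (g v + g u)) \<le> f v * (d v u * (f v + f u))"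
      by (simp add: mult.left_commute)
  qed
  then have "(\<Sum>v\<in>V. f v * signless_form V d f v) = x * (\<Sum>v\<in>V. (f v)\<^sup>2)"
    using bound[of f] eigenfunction_rayleigh[OF g] by (simp add: f_def)
  then have eq: "signless_form V d f v = x * f v" if "v \<in> V" for v
    using maximizer_is_eigen[OF fin sym bound] that by blast
  have nz: "\<exists>v\<in>V. f v \<noteq> 0" using g by (auto simp: eigenfunction_def f_def)
  have "f v > 0" if "v \<in> V" for v
  proof (rule ccontr)
    assume "\<not> f v > 0"
    then have fv: "f v = 0" by (simp add: f_def)
    \<comment> \<open>A zero of \<open>f\<close> makes a sum of nonnegative terms vanish; the
      weights to all other vertices are positive, so \<open>f\<close> vanishes everywhere on
      \<open>V\<close>.\<close>
    then have "(\<Sum>u\<in>V. d v u * (f v + f u)) = 0"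
      using eq[OF that] by (simp add: signless_form_def)
    then have z: "\<forall>u\<in>V. d v u * (f v + f u) = 0"
      using fin d0 that by (subst (asm) sum_nonneg_eq_0_iff) (auto simp: f_def)
    have "f u = 0" if "u \<in> V" for u
      using z that fv pos[OF \<open>v \<in> V\<close> that] by (cases "u = v") auto
    with nz show False by auto
  qed
  with eq nz have "eigenfunction V d x f \<and> (\<forall>v\<in>V. f v > 0)" by (simp add: eigenfunction_def)
  then show ?thesis by blast
qed

text \<open>The positive eigenfunction for \<open>d\<close> serves as a test function for
  \<open>d'\<close>: enlarging a weight enlarges its term of the quadratic form, strictly because
  \<open>f\<close> is positive.\<close>

lemma top_eigenvalue_strict_mono:
  assumes fin: "finite V"
    and sym: "\<And>u v. u \<in> V \<Longrightarrow> v \<in> V \<Longrightarrow> d u v = d v u"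
    and sym': "\<And>u v. u \<in> V \<Longrightarrow> v \<in> V \<Longrightarrow> d' u v = d' v u"
    and pos: "\<And>u v. u \<in> V \<Longrightarrow> v \<in> V \<Longrightarrow> u \<noteq> v \<Longrightarrow> d u v > 0"
    and nonneg: "\<And>u. u \<in> V \<Longrightarrow> d u u \<ge> 0"
    and le: "\<And>u v. u \<in> V \<Longrightarrow> v \<in> V \<Longrightarrow> d u v \<le> d' u v"
    and top: "top_eigenvalue V d x" and top': "top_eigenvalue V d' y"
  shows "x \<le> y" "\<exists>u\<in>V. \<exists>v\<in>V. d u v < d' u v \<Longrightarrow> x < y"
proof -
  obtain f where f: "eigenfunction V d x f" "\<And>v. v \<in> V \<Longrightarrow> f v > 0"
    using top_eigenvalue_positive_eigenfunction[OF fin sym pos nonneg top] by blast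
  have N: "(\<Sum>v\<in>V. (f v)\<^sup>2) > 0"
    using f(1) sum_squares_pos[OF fin] by (auto simp: eigenfunction_def)
  have bound: "(\<Sum>v\<in>V. f v * signless_form V d' f v) \<le> y * (\<Sum>v\<in>V. (f v)\<^sup>2)"
    by (rule top_eigenvalue_rayleigh[OF fin sym' top'])
  have term_le: "d v u * (f v * (f v + f u)) \<le> d' v u * (f v * (f v + f u))"
    if "v \<in> V" "u \<in> V" for u v
    using le[OF that] f(2)[OF that(1)] f(2)[OF that(2)] by (intro mult_right_mono) auto
  have eq: "f v * signless_form V e f v = (\<Sum>u\<in>V. e v u * (f v * (f v + f u)))" for e v
    by (simp add: signless_form_def sum_distrib_left mult.left_commute)
  have inner: "f v * signless_form V d f v \<le> f v * signless_form V d' f v" if "v \<in> V" for v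
    unfolding eq using term_le that by (intro sum_mono) auto
  have "x * (\<Sum>v\<in>V. (f v)\<^sup>2) \<le> (\<Sum>v\<in>V. f v * signless_form V d' f v)"
    unfolding eigenfunction_rayleigh[OF f(1), symmetric] using inner by (rule sum_mono)
  with bound N show "x \<le> y" by (meson le_less_trans mult_le_cancel_right not_less order_trans)
  assume "\<exists>u\<in>V. \<exists>v\<in>V. d u v < d' u v"
  then obtain a b where ab: "a \<in> V" "b \<in> V" "d a b < d' a b" by blast
  have "f a * signless_form V d f a < f a * signless_form V d' f a"
    unfolding eq
  proof (rule sum_strict_mono_ex1[OF fin])
    have "d a b * (f a * (f a + f b)) < d' a b * (f a * (f a + f b))"
      using ab f(2)[OF ab(1)] f(2)[OF ab(2)] by (intro mult_strict_right_mono) auto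
    then show "\<exists>u\<in>V. d a u * (f a * (f a + f u)) < d' a u * (f a * (f a + f u))"
      using ab by blast
  qed (use ab term_le in auto)
  then have "(\<Sum>v\<in>V. f v * signless_form V d f v) < (\<Sum>v\<in>V. f v * signless_form V d' f v)"
    by (intro sum_strict_mono_ex1 fin) (use inner ab in auto)
  with bound N show "x < y"
    unfolding eigenfunction_rayleigh[OF f(1)] by (meson less_le_trans mult_less_cancel_right_pos)
qed

section \<open>The quotient polynomial of a join\<close>

text \<open>
  \<open>H\<^sub>s\<close> is represented on an arbitrary vertex set by the clique \<open>S\<close> of size \<open>s\<close> joined to everything and
  the independent set \<open>I\<close> of size \<open>s + 1\<close>; \<open>join_dist S I\<close> is its distance function.
\<close>

definition join_dist :: "'a set \<Rightarrow> 'a set \<Rightarrow> 'a \<Rightarrow> 'a \<Rightarrow> real" where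
  "join_dist S I u v =
    (if u = v then 0 else if u \<in> S \<or> v \<in> S \<or> u \<notin> I \<and> v \<notin> I then 1 else 2)"

text \<open>
  \<open>quotient_poly n s X\<close> is the characteristic polynomial, at \<open>X + 2n - 2\<close>, of the quotient matrix of
  \<open>Q(H\<^sub>s)\<close> with respect to the three classes of vertices of \<open>H\<^sub>s\<close>.
\<close>

definition quotient_poly :: "real \<Rightarrow> real \<Rightarrow> real \<Rightarrow> real" where
  "quotient_poly n s X = (X + n) * (X\<^sup>2 - 4 * n + 4) - s * (X\<^sup>2 + (5 * n - 12) * X + 4 * n * (n - 3))
     + s\<^sup>2 * (8 * X + 8 * n - 2) - 2 * s ^ 3"

locale join_partition =
  fixes V S I :: "'a set" and n s :: nat
  assumes finite_V: "finite V" and S_sub: "S \<subseteq> V" and I_sub: "I \<subseteq> V" and disj: "S \<inter> I = {}"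
    and card_V: "card V = n" and card_S: "card S = s" and card_I: "card I = Suc s"
    and s_pos: "s > 0"
begin

text \<open>Counts the third class, the clique outside \<open>S\<close> and \<open>I\<close>; it is
  zero exactly when \<open>n = 2 * s + 1\<close>.\<close>

definition rest_size :: real where "rest_size = real n - 2 * real s - 1"

text \<open>
  The test vector satisfies the eigenvalue equations for \<open>X + 2n - 2\<close> outside \<open>S\<close>; the defect on \<open>S\<close>
  is a multiple of the quotient polynomial.
\<close>

definition test_vector :: "real \<Rightarrow> 'a \<Rightarrow> real" where
  "test_vector X v =
     (if v \<in> S then ((X + real s) * (X + real s + 2) - 2 * (s + 1) * (X + real s + 2 * rest_size)) / s
      else if v \<in> I then X + real s + 2 * rest_size
      else X + real s + 2)"

lemma size_le: "2 * s + 1 \<le> n"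
proof -
  have "card (S \<union> I) \<le> card V"
    using finite_V S_sub I_sub by (intro card_mono) auto
  then show ?thesis
    using card_Un_disjoint[of S I] disj finite_V S_sub I_sub
    by (simp add: card_S card_I card_V finite_subset)
qed

lemma rest_size_nonneg: "rest_size \<ge> 0"
  using size_le by (simp add: rest_size_def)

lemma sum_parts:
  fixes F :: "'a \<Rightarrow> real" and x y z :: real
  assumes "\<And>u. u \<in> S \<Longrightarrow> F u = x" "\<And>u. u \<in> I \<Longrightarrow> F u = y"
    "\<And>u. u \<in> V \<Longrightarrow> u \<notin> S \<Longrightarrow> u \<notin> I \<Longrightarrow> F u = z"
  shows "(\<Sum>u\<in>V. F u) = real s * x + (real s + 1) * y + rest_size * z"
proof -
  have fin: "finite S" "finite I" using finite_V S_sub I_sub by (auto intro: finite_subset)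
  have "card (V - (S \<union> I)) = n - (s + Suc s)"
    using card_Diff_subset[of "S \<union> I" V] card_Un_disjoint[of S I] fin disj S_sub I_sub
    by (simp add: card_V card_S card_I)
  then have R: "real (card (V - (S \<union> I))) = rest_size"
    using size_le by (simp add: rest_size_def)
  have "(\<Sum>u\<in>V. F u) = (\<Sum>u\<in>V - (S \<union> I). F u) + (\<Sum>u\<in>S \<union> I. F u)"
    using S_sub I_sub finite_V by (intro sum.subset_diff) auto
  also have "(\<Sum>u\<in>S \<union> I. F u) = (\<Sum>u\<in>S. F u) + (\<Sum>u\<in>I. F u)"
    using fin disj by (intro sum.union_disjoint)
  finally show ?thesis using assms R by (simp add: card_S card_I algebra_simps)
qed

lemma join_dist_sym: "join_dist S I u v = join_dist S I v u"
  by (auto simp: join_dist_def)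

lemma join_dist_pos: "u \<noteq> v \<Longrightarrow> join_dist S I u v > 0"
  by (auto simp: join_dist_def)

lemma join_dist_self: "join_dist S I u u = 0"
  by (auto simp: join_dist_def)

lemma signless_form_parts:
  fixes a b c :: real
  assumes v: "v \<in> V" and g: "\<And>u. u \<in> V \<Longrightarrow> g u = (if u \<in> S then a else if u \<in> I then c else b)"
  shows "signless_form V (join_dist S I) g v =
    (if v \<in> S then (2 * real s - 2) * a + (real s + 1) * (a + c) + rest_size * (a + b)
     else if v \<in> I then real s * (c + a) + 4 * real s * c + 2 * rest_size * (c + b)
     else real s * (b + a) + 2 * (real s + 1) * (b + c) + (2 * rest_size - 2) * b)"
proof -
  \<comment> \<open>Here the diagonal entry is 1 or 2 instead of 0, which makes the weights constant
    on each class; the surplus \<open>2 * e v * g v\<close> is subtracted afterwards.\<close>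
  define e :: "'a \<Rightarrow> real" where "e u = (if u \<in> S \<or> v \<in> S \<or> u \<notin> I \<and> v \<notin> I then 1 else 2)" for u
  have "signless_form V (join_dist S I) g v =
      (\<Sum>u\<in>V. e u * (g v + g u) - (if u = v then 2 * e v * g v else 0))"
    unfolding signless_form_def by (intro sum.cong refl) (auto simp: e_def join_dist_def)
  also have "\<dots> = (\<Sum>u\<in>V. e u * (g v + g u)) - 2 * e v * g v"
    using finite_V v by (simp add: sum_subtractf)
  finally have *: "signless_form V (join_dist S I) g v = (\<Sum>u\<in>V. e u * (g v + g u)) - 2 * e v * g v" .
  have I: "u \<in> I \<Longrightarrow> u \<in> V \<and> u \<notin> S" and S: "u \<in> S \<Longrightarrow> u \<in> V" for u
    using S_sub I_sub disj by auto
  consider "v \<in> S" | "v \<notin> S" "v \<in> I" | "v \<notin> S" "v \<notin> I" by blast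
  then show ?thesis
  proof cases
    case 1
    have "(\<Sum>u\<in>V. e u * (g v + g u)) = real s * (2 * a) + (real s + 1) * (a + c) + rest_size * (a + b)"
      by (rule sum_parts) (use 1 v I S in \<open>auto simp: e_def g\<close>)
    moreover have "e v * g v = a" using 1 v by (simp add: e_def g)
    ultimately show ?thesis unfolding * using 1 by (simp add: algebra_simps)
  next
    case 2
    have "(\<Sum>u\<in>V. e u * (g v + g u)) = real s * (c + a) + (real s + 1) * (2 * (2 * c)) + rest_size * (2 * (c + b))"
      by (rule sum_parts) (use 2 v I S in \<open>auto simp: e_def g\<close>)
    moreover have "e v * g v = 2 * c" using 2 v by (simp add: e_def g)
    ultimately show ?thesis unfolding * using 2 by (simp add: algebra_simps)
  next
    case 3
    have "(\<Sum>u\<in>V. e u * (g v + g u)) = real s * (b + a) + (real s + 1) * (2 * (b + c)) + rest_size * (2 * b)"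
      by (rule sum_parts) (use 3 v I S in \<open>auto simp: e_def g\<close>)
    moreover have "e v * g v = b" using 3 v by (simp add: e_def g)
    ultimately show ?thesis unfolding * using 3 by (simp add: algebra_simps)
  qed
qed

lemma signless_form_test_vector:
  assumes v: "v \<in> V"
  shows "signless_form V (join_dist S I) (test_vector X) v =
    (X + 2 * real n - 2) * test_vector X v - (if v \<in> S then quotient_poly n s X / real s else 0)"
proof -
  define a where "a = ((X + real s) * (X + real s + 2) - 2 * (real s + 1) * (X + real s + 2 * rest_size)) / real s"
  have sa: "real s * a = (X + real s) * (X + real s + 2) - 2 * (real s + 1) * (X + real s + 2 * rest_size)"
    using s_pos by (simp add: a_def)
  let ?b = "X + real s + 2" and ?c = "X + real s + 2 * rest_size"
  have g: "test_vector X u = (if u \<in> S then a else if u \<in> I then ?c else ?b)" for u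
    by (simp add: test_vector_def a_def)
  note form = signless_form_parts[OF v, of "test_vector X" a ?c ?b, OF g]
  consider "v \<in> S" | "v \<notin> S" "v \<in> I" | "v \<notin> S" "v \<notin> I" by blast
  then show ?thesis
  proof cases
    case 1
    \<comment> \<open>The value \<open>a\<close> on \<open>S\<close> has denominator
      \<open>s\<close>; after multiplication only the polynomial \<open>real s * a\<close>
      occurs.\<close>
    have "real s * ((X + 2 * real n - 2) * a - ((2 * real s - 2) * a + (real s + 1) * (a + ?c) + rest_size * (a + ?b)))
       = quotient_poly n s X"
    proof -
      have "real s * ((X + 2 * real n - 2) * a - ((2 * real s - 2) * a + (real s + 1) * (a + ?c) + rest_size * (a + ?b)))
        = (X + real n - real s) * (real s * a) - real s * ((real s + 1) * ?c + rest_size * ?b)"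
        by (simp add: rest_size_def algebra_simps)
      also have "\<dots> = quotient_poly n s X"
        unfolding sa quotient_poly_def rest_size_def
        by (simp add: algebra_simps power2_eq_square power3_eq_cube)
      finally show ?thesis .
    qed
    then have "(X + 2 * real n - 2) * a - ((2 * real s - 2) * a + (real s + 1) * (a + ?c) + rest_size * (a + ?b))
       = quotient_poly n s X / real s"
      using s_pos by (simp add: field_simps)
    then show ?thesis using 1 form g[of v] by simp
  next
    case 2
    have "real s * (?c + a) + 4 * real s * ?c + 2 * rest_size * (?c + ?b) = (X + 2 * real n - 2) * ?c"
      using sa by (simp add: algebra_simps rest_size_def)
    then show ?thesis using 2 form g[of v] by simp
  next
    case 3
    have "real s * (?b + a) + 2 * (real s + 1) * (?b + ?c) + (2 * rest_size - 2) * ?b = (X + 2 * real n - 2) * ?b"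
      using sa by (simp add: algebra_simps rest_size_def)
    then show ?thesis using 3 form g[of v] by simp
  qed
qed

text \<open>The point 0 corresponds to the eigenvalue \<open>2n - 2\<close>, so this makes the
  shifted largest eigenvalue positive. The value is regrouped into products whose signs follow from
  \<open>rest_size \<ge> 0\<close> and \<open>s \<le> n\<close>.\<close>

lemma quotient_poly_zero_neg: "quotient_poly n s 0 < 0"
proof -
  have "quotient_poly n s 0 = - (real n - real s) * ((real s)\<^sup>2 + 4 * (real s + 1) * rest_size)
      - real s * (rest_size * (3 * s + 4) + (real s + 1) * real s)"
    using size_le unfolding quotient_poly_def rest_size_def
    by (simp add: algebra_simps power2_eq_square power3_eq_cube of_nat_diff)
  moreover have "(real n - real s) * ((real s)\<^sup>2 + 4 * (real s + 1) * rest_size) \<ge> 0"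
    "real s * (rest_size * (3 * s + 4)) \<ge> 0" "real s * ((real s + 1) * real s) > 0"
    using rest_size_nonneg s_pos size_le by auto
  ultimately show ?thesis by (simp add: algebra_simps)
qed

text \<open>At a root the defect on \<open>S\<close> disappears; the test vector is nonzero because
  it is positive on \<open>I\<close>.\<close>

lemma eigenvalue_of_root:
  assumes "quotient_poly n s X = 0" "(X :: real) \<ge> 0"
  shows "eigenfunction V (join_dist S I) (X + 2 * real n - 2) (test_vector X)"
proof -
  obtain v where v: "v \<in> I" using card_I by fastforce
  then have "test_vector X v \<noteq> 0"
    using disj assms(2) s_pos rest_size_nonneg by (auto simp: test_vector_def)
  then show ?thesis
    using v I_sub signless_form_test_vector[of _ X] assms(1) unfolding eigenfunction_def by auto
qed

context
  fixes x :: real assumes top: "top_eigenvalue V (join_dist S I) x"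
begin

text \<open>The test vector is paired with a positive eigenfunction \<open>f\<close>. By
  self-adjointness the defect contributes the polynomial times the positive number
  \<open>(\<Sum>v\<in>S. f v) / s\<close>, and this must be zero.\<close>

lemma quotient_poly_top: "quotient_poly n s (x - 2 * real n + 2) = 0"
proof -
  let ?X = "x - 2 * real n + 2"
  obtain f where f: "eigenfunction V (join_dist S I) x f" "\<And>v. v \<in> V \<Longrightarrow> f v > 0"
    using top_eigenvalue_positive_eigenfunction[OF finite_V join_dist_sym join_dist_pos
        eq_refl[OF join_dist_self[symmetric]] top] by blast
  have "(\<Sum>v\<in>V. test_vector ?X v * signless_form V (join_dist S I) f v) =
      (\<Sum>v\<in>V. f v * signless_form V (join_dist S I) (test_vector ?X) v)"
    by (rule signless_form_symmetric) (rule join_dist_sym)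
  moreover have "(\<Sum>v\<in>V. test_vector ?X v * signless_form V (join_dist S I) f v) =
      (\<Sum>v\<in>V. x * (f v * test_vector ?X v))"
    using f(1) by (intro sum.cong) (auto simp: eigenfunction_def)
  moreover have "(\<Sum>v\<in>V. f v * signless_form V (join_dist S I) (test_vector ?X) v) =
     (\<Sum>v\<in>V. x * (f v * test_vector ?X v) - (if v \<in> S then quotient_poly n s ?X / real s * f v else 0))"
    by (intro sum.cong refl) (subst signless_form_test_vector, auto simp: algebra_simps)
  ultimately have "(\<Sum>v\<in>V. if v \<in> S then quotient_poly n s ?X / real s * f v else 0) = 0"
    by (simp add: sum_subtractf)
  moreover have "(\<Sum>v\<in>V. if v \<in> S then quotient_poly n s ?X / real s * f v else 0) =
      quotient_poly n s ?X / real s * (\<Sum>v\<in>S. f v)"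
    using finite_V S_sub by (simp add: sum.inter_restrict[symmetric] Int_absorb1 sum_distrib_left)
  moreover have "(\<Sum>v\<in>S. f v) > 0"
    using f(2) S_sub finite_V s_pos card_S by (intro sum_pos) (auto intro: finite_subset)
  ultimately show ?thesis using s_pos by simp
qed

text \<open>The cubic is monic, so a negative value at \<open>X\<close> forces a root beyond
  \<open>X\<close>, and that root yields an eigenvalue not exceeding the top one.\<close>

lemma top_greater:
  assumes "quotient_poly n s X < 0" "X \<ge> 0"
  shows "X < x - 2 * real n + 2"
proof -
  have "eventually (\<lambda>Y. quotient_poly n s Y > 0) at_top"
    unfolding quotient_poly_def by real_asymp
  then obtain Z where Z: "quotient_poly n s Z > 0" "Z \<ge> X"
    unfolding eventually_at_top_linorder by (metis linear)
  have "\<exists>Y. X \<le> Y \<and> Y \<le> Z \<and> quotient_poly n s Y = 0"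
    using assms(1) Z by (intro IVT') (auto simp: quotient_poly_def intro!: continuous_intros)
  then obtain Y where Y: "X \<le> Y" "quotient_poly n s Y = 0" by blast
  then have "X < Y" using assms(1) by (cases "X = Y") auto
  moreover have "Y + 2 * real n - 2 \<le> x"
    using eigenvalue_of_root[OF Y(2)] Y(1) assms(2) top by (auto simp: top_eigenvalue_def)
  ultimately show ?thesis by simp
qed

lemma top_pos: "x - 2 * real n + 2 > 0"
  using top_greater[OF quotient_poly_zero_neg] by simp

end

end

text \<open>Only \<open>n\<close> and \<open>s\<close> enter the cubic: the largest eigenvalue of
  each side gives a positive root, hence an eigenvalue of the other side.\<close>

lemma top_eigenvalue_join_eq:
  assumes "join_partition V S I n s" "join_partition V' S' I' n s"
    and "top_eigenvalue V (join_dist S I) x" "top_eigenvalue V' (join_dist S' I') y"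
  shows "x = y"
proof -
  interpret A: join_partition V S I n s by fact
  interpret B: join_partition V' S' I' n s by fact
  have "y \<le> x"
    using A.eigenvalue_of_root[OF B.quotient_poly_top[OF assms(4)]] B.top_pos[OF assms(4)] assms(3)
    by (auto simp: top_eigenvalue_def)
  moreover have "x \<le> y"
    using B.eigenvalue_of_root[OF A.quotient_poly_top[OF assms(3)]] A.top_pos[OF assms(3)] assms(4)
    by (auto simp: top_eigenvalue_def)
  ultimately show ?thesis by simp
qed

text \<open>For fixed \<open>X\<close> the polynomial is convex in \<open>s\<close> on the relevant range.\<close>

lemma quotient_poly_chord:
  assumes "X \<ge> 0" "1 < s" "s \<le> (n - 1) / 2" "n \<ge> 1"
    and "quotient_poly n 1 X \<le> 0" "quotient_poly n ((n - 1) / 2) X < 0"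
  shows "quotient_poly n s X < 0"
proof -
  define t where "t = (n - 1) / 2"
  \<comment> \<open>Exact interpolation between 1 and \<open>t\<close>; the last factor is the
    second divided difference in \<open>s\<close>.\<close>
  have "(t - 1) * quotient_poly n s X = (t - s) * quotient_poly n 1 X + (s - 1) * quotient_poly n t X
      - (t - 1) * (s - 1) * (t - s) * (8 * X + 8 * n - 4 - 2 * (s + t))"
    unfolding quotient_poly_def by (simp add: algebra_simps power2_eq_square power3_eq_cube)
  moreover have "(t - s) * quotient_poly n 1 X \<le> 0"
    using assms by (intro mult_nonneg_nonpos) (auto simp: t_def)
  moreover have "(s - 1) * quotient_poly n t X < 0"
    using assms by (intro mult_pos_neg) (auto simp: t_def)
  moreover have "(t - 1) * (s - 1) * (t - s) * (8 * X + 8 * n - 4 - 2 * (s + t)) \<ge> 0"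
    using assms by (intro mult_nonneg_nonneg) (auto simp: t_def field_simps)
  ultimately have "(t - 1) * quotient_poly n s X < 0" by linarith
  moreover have "t - 1 > 0" using assms by (simp add: t_def)
  ultimately show ?thesis by (simp add: mult_less_0_iff)
qed

text \<open>The root for \<open>s = 1\<close> is at most of order sqrt(8n), while the cubic at the
  right end stays negative up to order \<open>n\<close>; convexity covers what lies between.\<close>

lemma quotient_poly_neg_of_pendant_root:
  assumes "X \<ge> 0" "1 < s" "s \<le> (n - 1) / 2" "n \<ge> 17" "quotient_poly n 1 X = 0"
  shows "quotient_poly n s X < 0"
proof -
  \<comment> \<open>The cubic for \<open>s = 1\<close>, arranged so that the factor
    \<open>X + n - 1\<close> can be cancelled to bound the square of \<open>X\<close>.\<close>
  have "(X + n - 1) * (X\<^sup>2 - 8 * n + 23) = (n - 1) * X + 7 * n - 19"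
    using assms(5) unfolding quotient_poly_def by (simp add: algebra_simps power2_eq_square power3_eq_cube)
  also have "\<dots> \<le> (X + n - 1) * (X + 7)"
    using assms(1) by (simp add: algebra_simps power2_eq_square)
  finally have sq: "X\<^sup>2 \<le> X + 8 * n - 16"
    using assms by simp
  \<comment> \<open>Chosen so that \<open>X < k\<close> together with \<open>sq\<close> gives the
    bound on \<open>X\<^sup>2 + X\<close> that makes the cubic at the right end negative.\<close>
  define k where "k = (n\<^sup>2 - 16 * n + 31) / 4"
  \<comment> \<open>In terms of \<open>m\<close> all coefficients of \<open>k\<close> are positive;
    this is where \<open>n \<ge> 17\<close> enters.\<close>
  define m where "m = n - 17"
  have n: "n = m + 17" and "m \<ge> 0" using assms by (auto simp: m_def)
  have k: "k = 12 + m * (9/2) + m\<^sup>2 / 4" by (simp add: k_def n algebra_simps power2_eq_square)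
  have "X < k"
  proof (rule ccontr)
    assume "\<not> X < k"
    then have X: "X \<ge> 12 + m * (9/2)" using k by (smt (verit) zero_le_power2 divide_nonneg_pos)
    then have "X * (X - 1) \<ge> (12 + m * (9/2)) * 11"
      using \<open>m \<ge> 0\<close> by (intro mult_mono) auto
    with sq \<open>m \<ge> 0\<close> n show False by (simp add: algebra_simps power2_eq_square)
  qed
  then have "X\<^sup>2 + X < (n\<^sup>2 - 1) / 2" using sq by (simp add: k_def)
  \<comment> \<open>At the right end the cubic factors. For even \<open>n\<close> this end is not an
    integer and only bounds the range of \<open>s\<close>.\<close>
  moreover have "quotient_poly n ((n - 1) / 2) X = (X + (n - 1) / 2) * (X\<^sup>2 + X - (n\<^sup>2 - 1) / 2)"
    unfolding quotient_poly_def by (simp add: field_simps power2_eq_square power3_eq_cube)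
  ultimately have "quotient_poly n ((n - 1) / 2) X < 0"
    using assms(1,4) by (simp add: mult_pos_neg add_nonneg_pos)
  with assms show ?thesis by (simp add: quotient_poly_chord)
qed

section \<open>Distances and spanning subgraphs of joins\<close>

lemma top_eigenvalue_cong:
  assumes "\<And>u v. u \<in> V \<Longrightarrow> v \<in> V \<Longrightarrow> d u v = d' u v"
  shows "top_eigenvalue V d x = top_eigenvalue V d' x"
proof -
  have "signless_form V d f v = signless_form V d' f v" if "v \<in> V" for f v
    unfolding signless_form_def using that assms by (intro sum.cong) auto
  then show ?thesis unfolding top_eigenvalue_def eigenfunction_def by simp
qed

locale connected_graph = pair_graph G for G :: "'a pair_pre_digraph" +
  assumes conn: "Digraph_Component.connected (with_proj G)"
begin

lemma gdist_attained:
  assumes "u \<in> pverts G" "v \<in> pverts G"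
  obtains p where "apath u p v" "length p = gdist G u v"
proof -
  have "strongly_connected (with_proj G)"
    using symmetric_connected_imp_strongly_connected[OF sym_arcs conn] .
  then have "u \<rightarrow>\<^sup>*\<^bsub>with_proj G\<^esub> v" using assms by (auto simp: strongly_connected_def)
  then have "\<exists>p. apath u p v" by (simp add: reachable_apath)
  then have "\<exists>k. \<exists>p. apath u p v \<and> length p = k" by blast
  from LeastI_ex[OF this] show thesis using that unfolding gdist_def by blast
qed

lemma gdist_le: "apath u p v \<Longrightarrow> gdist G u v \<le> length p"
  unfolding gdist_def by (rule Least_le) blast

lemma gdist_sym:
  assumes "u \<in> pverts G" "v \<in> pverts G"
  shows "gdist G u v = gdist G v u"
proof -
  have "gdist G u v \<le> gdist G v u" if uv: "u \<in> pverts G" "v \<in> pverts G" for u v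
  proof -
    obtain p where p: "apath v p u" "length p = gdist G v u"
      using gdist_attained[OF uv(2,1)] .
    have "length (rev_path p) = length p" by (induction p) auto
    then show ?thesis using gdist_le[of u "rev_path p" v] p by simp
  qed
  then show ?thesis using assms by (simp add: order_antisym)
qed

lemma gdist_ge:
  assumes "u \<in> pverts G" "v \<in> pverts G" "u \<noteq> v"
  shows "(if (u, v) \<in> parcs G then 1 else 2) \<le> gdist G u v"
proof -
  obtain p where p: "apath u p v" "length p = gdist G u v" using gdist_attained[OF assms(1,2)] .
  have "p \<noteq> []" using p(1) assms(3) by (auto simp: apath_Nil_iff)
  then obtain e q where e: "p = e # q" by (cases p) auto
  have "(u, v) \<in> parcs G" if "q = []"
    using p(1) unfolding e that by (cases e) (auto simp: apath_Cons_iff apath_Nil_iff)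
  then show ?thesis using p(2) e by (cases q) auto
qed

lemma gdist_self: "u \<in> pverts G \<Longrightarrow> gdist G u u = 0"
  using gdist_le[of u "[]" u] by (simp add: apath_Nil_iff)

lemma gdist_arc:
  assumes "(u, v) \<in> parcs G"
  shows "gdist G u v = 1"
proof -
  have uv: "u \<noteq> v" "u \<in> pverts G" "v \<in> pverts G"
    using assms no_loops' wellformed' by auto
  then have "apath u [(u, v)] v" using assms by (simp add: apath_Cons_iff apath_Nil_iff)
  then show ?thesis using gdist_le[of u "[(u, v)]" v] gdist_ge[of u v] uv assms by simp
qed

lemma gdist_common_neighbour:
  assumes "(u, w) \<in> parcs G" "(w, v) \<in> parcs G" "u \<noteq> v" "(u, v) \<notin> parcs G"
  shows "gdist G u v = 2"
proof -
  have uv: "u \<noteq> w" "w \<noteq> v" "u \<in> pverts G" "v \<in> pverts G" "w \<in> pverts G"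
    using assms no_loops' wellformed' by auto
  then have "apath u [(u, w), (w, v)] v" using assms by (simp add: apath_Cons_iff apath_Nil_iff)
  then show ?thesis using gdist_le[of u "[(u, w), (w, v)]" v] gdist_ge[of u v] uv assms by simp
qed

text \<open>Carries the Rayleigh theory over to \<open>eta\<close>. The maximum is meaningful
  because the eigenvalues are roots of a monic polynomial, hence finitely many.\<close>

lemma top_eigenvalue_eta: "top_eigenvalue (pverts G) (\<lambda>u v. real (gdist G u v)) (eta G)"
proof -
  let ?d = "\<lambda>u v. real (gdist G u v)"
  obtain vs where vs: "distinct vs" "set vs = pverts G"
    using finite_distinct_list[OF pair_finite_verts] by blast
  have "pverts G \<noteq> {}" using conn by (auto simp: connected_conv)
  then obtain x where x: "top_eigenvalue (pverts G) ?d x"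
    using top_eigenvalue_exists[of "pverts G" ?d] pair_finite_verts gdist_sym by metis
  let ?Q = "distance_signless_laplacian G vs"
  have iff: "eigenvalue ?Q y \<longleftrightarrow> (\<exists>f. eigenfunction (pverts G) ?d y f)" for y
    unfolding eigenvalue_distance_signless_laplacian_iff[OF vs] eigenfunction_def signless_form_def
    by (simp add: transmission_def algebra_simps sum.distrib sum_distrib_left sum_distrib_right)
  have carrier: "?Q \<in> carrier_mat (length vs) (length vs)"
    by (simp add: distance_signless_laplacian_def transmission_matrix_def distance_matrix_def)
  have "finite {y. poly (char_poly ?Q) y = 0}"
    using degree_monic_char_poly[OF carrier] by (intro poly_roots_finite) auto
  then have "finite {y. eigenvalue ?Q y}" by (simp add: eigenvalue_root_char_poly[OF carrier])
  then have "Max {y. eigenvalue ?Q y} = x"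
    using x by (intro Max_eqI) (auto simp: iff top_eigenvalue_def)
  then show ?thesis using x eta_eq[OF vs] by simp
qed

end

section \<open>Joins on a prescribed vertex set and their spanning subgraphs\<close>

definition join_graph :: "'a set \<Rightarrow> 'a set \<Rightarrow> 'a set \<Rightarrow> 'a pair_pre_digraph" where
  "join_graph V S I = \<lparr> pverts = V,
     parcs = {(u, v). u \<in> V \<and> v \<in> V \<and> u \<noteq> v \<and> (u \<in> S \<or> v \<in> S \<or> u \<notin> I \<and> v \<notin> I)} \<rparr>"

context join_partition
begin

lemma S_nonempty: "S \<noteq> {}"
  using card_S s_pos by auto

sublocale J: connected_graph "join_graph V S I"
proof -
  interpret pair_graph "join_graph V S I"
    using finite_V by (auto simp: pair_graph_iff join_graph_def sym_def irrefl_def)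
  \<comment> \<open>A vertex of \<open>S\<close> is adjacent to all others and so connects the
    graph.\<close>
  obtain c where c: "c \<in> S" using S_nonempty by auto
  have c_reach: "c \<rightarrow>\<^sup>*\<^bsub>with_proj (join_graph V S I)\<^esub> v" if "v \<in> V" for v
  proof (cases "v = c")
    case True
    have "c \<in> pverts (join_graph V S I)" using that True by (simp add: join_graph_def)
    then show ?thesis using True by simp
  next
    case False
    then have "(c, v) \<in> parcs (join_graph V S I)" using that c S_sub by (auto simp: join_graph_def)
    then show ?thesis by (simp add: reachable_adjI)
  qed
  then have "u \<rightarrow>\<^sup>*\<^bsub>with_proj (join_graph V S I)\<^esub> v" if "u \<in> V" "v \<in> V" for u v
    using that symmetric_reachable[OF sym_arcs] reachable_trans by blast
  then have "strongly_connected (with_proj (join_graph V S I))"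
    using c S_sub by (auto simp: strongly_connected_def join_graph_def)
  then have "Digraph_Component.connected (with_proj (join_graph V S I))"
    unfolding Digraph_Component.connected_def strongly_connected_def
    by (auto simp: reachable_mk_symmetricI)
  then show "connected_graph (join_graph V S I)" by unfold_locales
qed

text \<open>Distinct nonadjacent vertices have a common neighbour in \<open>S\<close>, so distances
  never exceed 2.\<close>

lemma gdist_join_graph:
  assumes "u \<in> V" "v \<in> V"
  shows "real (gdist (join_graph V S I) u v) = join_dist S I u v"
proof -
  obtain c where c: "c \<in> S" "c \<in> V" using S_nonempty S_sub by auto
  show ?thesis
  proof (cases "u = v \<or> (u, v) \<in> parcs (join_graph V S I)")
    case True
    then show ?thesis
      using assms J.gdist_self[of u] J.gdist_arc[of u v] by (auto simp: join_dist_def join_graph_def)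
  next
    case False
    have "(u, c) \<in> parcs (join_graph V S I)" "(c, v) \<in> parcs (join_graph V S I)"
      using False c assms by (auto simp: join_graph_def)
    then have "gdist (join_graph V S I) u v = 2"
      using False by (intro J.gdist_common_neighbour) auto
    then show ?thesis using False assms by (auto simp: join_dist_def join_graph_def)
  qed
qed

lemma top_eigenvalue_join_graph: "top_eigenvalue V (join_dist S I) (eta (join_graph V S I))"
proof -
  have V: "pverts (join_graph V S I) = V" by (simp add: join_graph_def)
  show ?thesis
    using J.top_eigenvalue_eta top_eigenvalue_cong[of V _ "join_dist S I", OF gdist_join_graph]
    unfolding V by blast
qed

text \<open>The condition on \<open>I\<close> makes \<open>G\<close> a spanning subgraph of the
  join, so its distances are at least those of the join. Equal largest eigenvalues exclude any
  strict increase, and distance 1 recovers the missing arcs.\<close>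

lemma eta_subgraph:
  assumes G: "connected_graph G" "pverts G = V"
    and sub: "\<And>u v. u \<in> I \<Longrightarrow> (u, v) \<in> parcs G \<Longrightarrow> v \<in> S"
  shows "eta (join_graph V S I) \<le> eta G"
    and "eta G = eta (join_graph V S I) \<Longrightarrow> G = join_graph V S I"
proof -
  interpret G: connected_graph G by fact
  have sub': "(u, v) \<in> parcs (join_graph V S I)" if "(u, v) \<in> parcs G" for u v
    using that sub[of u v] sub[of v u] G.no_loops'[of u] G.wellformed' G.pair_sym_arcs G(2)
    by (auto simp: join_graph_def symmetric_def dest: symD)
  have le: "join_dist S I u v \<le> real (gdist G u v)" if "u \<in> V" "v \<in> V" for u v
  proof (cases "u = v")
    case False
    then show ?thesis using that G.gdist_ge[of u v] sub'[of u v] G(2)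
      by (auto simp: join_dist_def join_graph_def split: if_splits)
  qed (simp add: join_dist_def)
  note mono = top_eigenvalue_strict_mono[OF finite_V join_dist_sym _ join_dist_pos _ le
      top_eigenvalue_join_graph, of "eta G"]
  have top: "top_eigenvalue V (\<lambda>u v. real (gdist G u v)) (eta G)"
    using G.top_eigenvalue_eta G(2) by simp
  show "eta (join_graph V S I) \<le> eta G"
    by (rule mono(1)) (use top G.gdist_sym G(2) in \<open>auto simp: join_dist_self\<close>)
  assume eq: "eta G = eta (join_graph V S I)"
  have no_less: "\<not> (\<exists>u\<in>V. \<exists>v\<in>V. join_dist S I u v < real (gdist G u v))"
  proof
    assume "\<exists>u\<in>V. \<exists>v\<in>V. join_dist S I u v < real (gdist G u v)"
    then have "eta (join_graph V S I) < eta G"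
      by (intro mono(2)) (use top G.gdist_sym G(2) in \<open>auto simp: join_dist_self\<close>)
    with eq show False by simp
  qed
  have "(u, v) \<in> parcs G" if uv: "(u, v) \<in> parcs (join_graph V S I)" for u v
  proof -
    have "u \<in> V" "v \<in> V" "u \<noteq> v" "join_dist S I u v = 1"
      using uv by (auto simp: join_graph_def join_dist_def)
    then have "real (gdist G u v) \<le> 1" using no_less by force
    then show ?thesis using G.gdist_ge[of u v] \<open>u \<in> V\<close> \<open>v \<in> V\<close> \<open>u \<noteq> v\<close> G(2)
      by (auto split: if_splits)
  qed
  with sub' have "parcs G = parcs (join_graph V S I)" by auto
  then show "G = join_graph V S I" using G(2) by (simp add: join_graph_def)
qed

end

section \<open>Comparison of the extremal graphs\<close>

text \<open>The sizes of the three classes are fixed by \<open>n\<close> and \<open>s\<close>.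
  Bijections between corresponding classes are glued; adjacency of distinct vertices depends only on
  their classes.\<close>

lemma graph_iso_join_graph:
  assumes "join_partition V S I n s" "join_partition V' S' I' n s"
  shows "graph_iso (join_graph V S I) (join_graph V' S' I')"
proof -
  interpret A: join_partition V S I n s by fact
  interpret B: join_partition V' S' I' n s by fact
  have fin: "finite S" "finite I" "finite S'" "finite I'"
    using A.finite_V A.S_sub A.I_sub B.finite_V B.S_sub B.I_sub by (auto intro: finite_subset)
  have "card (V - (S \<union> I)) = card (V' - (S' \<union> I'))"
    using fin A.S_sub A.I_sub B.S_sub B.I_sub A.disj B.disj
    by (simp add: card_Diff_subset card_Un_disjoint A.card_V B.card_V A.card_S B.card_S A.card_I B.card_I)
  then obtain h where h: "bij_betw h (V - (S \<union> I)) (V' - (S' \<union> I'))"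
    using A.finite_V B.finite_V
      finite_same_card_bij[of "V - (S \<union> I)" "V' - (S' \<union> I')"] by auto
  obtain f where f: "bij_betw f S S'"
    using fin finite_same_card_bij[of S S'] by (auto simp: A.card_S B.card_S)
  obtain g where g: "bij_betw g I I'"
    using fin finite_same_card_bij[of I I'] by (auto simp: A.card_I B.card_I)
  define k where "k v = (if v \<in> S then f v else if v \<in> I then g v else h v)" for v
  have kS: "bij_betw k S S'"
    using f by (rule bij_betw_cong[THEN iffD1, rotated]) (simp add: k_def)
  have kI: "bij_betw k I I'"
    using g by (rule bij_betw_cong[THEN iffD1, rotated]) (use A.disj in \<open>auto simp: k_def\<close>)
  have kR: "bij_betw k (V - (S \<union> I)) (V' - (S' \<union> I'))"
    using h by (rule bij_betw_cong[THEN iffD1, rotated]) (simp add: k_def)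
  have "bij_betw k (S \<union> I \<union> (V - (S \<union> I))) (S' \<union> I' \<union> (V' - (S' \<union> I')))"
    using kS kI kR B.disj by (intro bij_betw_combine) auto
  moreover have "S \<union> I \<union> (V - (S \<union> I)) = V" "S' \<union> I' \<union> (V' - (S' \<union> I')) = V'"
    using A.S_sub A.I_sub B.S_sub B.I_sub by auto
  ultimately have k: "bij_betw k V V'" by simp
  have inj: "inj_on k V" and img: "k ` V = V'" using k by (auto simp: bij_betw_def)
  have kS_iff: "k v \<in> S' \<longleftrightarrow> v \<in> S" if "v \<in> V" for v
    using inj_on_image_mem_iff[OF inj that A.S_sub] kS by (simp add: bij_betw_def)
  have kI_iff: "k v \<in> I' \<longleftrightarrow> v \<in> I" if "v \<in> V" for v
    using inj_on_image_mem_iff[OF inj that A.I_sub] kI by (simp add: bij_betw_def)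
  have edge: "(k u, k v) \<in> parcs (join_graph V' S' I') \<longleftrightarrow> (u, v) \<in> parcs (join_graph V S I)"
    if "u \<in> V" "v \<in> V" for u v
    using that kS_iff kI_iff img inj_on_eq_iff[OF inj that] by (auto simp: join_graph_def)
  show ?thesis
  proof (rule graph_isoI)
    show "pair_wf_digraph (join_graph V S I)" by unfold_locales
    show "inj_on k (pverts (join_graph V S I))" using inj by (simp add: join_graph_def)
    show "pverts (join_graph V' S' I') = k ` pverts (join_graph V S I)"
      using img by (simp add: join_graph_def)
    show "parcs (join_graph V' S' I') = map_prod k k ` parcs (join_graph V S I)"
    proof (intro equalityI subsetI)
      fix e assume e: "e \<in> parcs (join_graph V' S' I')"
      then have "fst e \<in> k ` V" "snd e \<in> k ` V" unfolding img by (auto simp: join_graph_def)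
      then obtain u v where uv: "u \<in> V" "v \<in> V" "e = (k u, k v)" by (cases e) auto
      with e edge[OF uv(1,2)] have "(u, v) \<in> parcs (join_graph V S I)" by simp
      then have "map_prod k k (u, v) \<in> map_prod k k ` parcs (join_graph V S I)" by (rule imageI)
      then show "e \<in> map_prod k k ` parcs (join_graph V S I)" using uv(3) by simp
    next
      fix e assume "e \<in> map_prod k k ` parcs (join_graph V S I)"
      then obtain u v where uv: "(u, v) \<in> parcs (join_graph V S I)" "e = (k u, k v)" by auto
      moreover from uv have "u \<in> V" "v \<in> V" by (auto simp: join_graph_def)
      ultimately show "e \<in> parcs (join_graph V' S' I')" using edge by simp
    qed
  qed
qed

text \<open>The centre \<open>K\<^sub>1\<close> is \<open>S\<close> and the two pendant vertices
  form \<open>I\<close>, hence \<open>s = 1\<close>.\<close>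

lemma pendant_graph_eq:
  assumes "n \<ge> 3"
  shows "pendant_graph n = join_graph (pverts (pendant_graph n)) {Inl 0} (Inr ` Inr ` {..<2 :: nat})"
    and "join_partition (pverts (pendant_graph n)) {Inl 0} (Inr ` Inr ` {..<2 :: nat}) n 1"
proof -
  let ?G = "pendant_graph n"
  have V: "pverts ?G = insert (Inl 0) (Inr ` (Inl ` {..<n - 3} \<union> Inr ` {..<2}))"
    by (auto simp: pendant_graph_def graph_join_def disjoint_union_def complete_graph_def edgeless_graph_def)
  show "join_partition (pverts ?G) {Inl 0} (Inr ` Inr ` {..<2 :: nat}) n 1"
  proof
    show "card (pverts ?G) = n" using assms by (rule card_pverts_pendant_graph)
    show "card (Inr ` Inr ` {..<2 :: nat} :: (nat + nat + nat) set) = Suc 1" by (simp add: card_image)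
  qed (auto simp: V)
  show "?G = join_graph (pverts ?G) {Inl 0} (Inr ` Inr ` {..<2 :: nat})"
  proof (rule pair_pre_digraph.equality)
    show "parcs ?G = parcs (join_graph (pverts ?G) {Inl 0} (Inr ` Inr ` {..<2 :: nat}))"
      unfolding join_graph_def V
      by (auto simp: pendant_graph_def graph_join_def disjoint_union_def complete_graph_def edgeless_graph_def)
  qed (simp_all add: join_graph_def)
qed

text \<open>
  For even \<open>n\<close> one of the \<open>n div 2 + 1\<close> independent vertices of \<open>hat_graph n\<close> plays the role of the
  remaining clique \<open>K\<^sub>1\<close>.
\<close>

definition hat_size :: "nat \<Rightarrow> nat" where
  "hat_size n = (n - 1) div 2"

lemma hat_graph_eq:
  assumes "n \<ge> 3"
  defines "S \<equiv> Inl ` {..<hat_size n}" and "I \<equiv> Inr ` {..<Suc (hat_size n)}"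
  shows "hat_graph n = join_graph (pverts (hat_graph n)) S I"
    and "join_partition (pverts (hat_graph n)) S I n (hat_size n)"
proof -
  let ?G = "hat_graph n" and ?s = "hat_size n"
  have G: "?G = graph_join (complete_graph ?s) (edgeless_graph (n - ?s))"
  proof (cases "odd n")
    case True
    then have "(n + 1) div 2 = n - (n - 1) div 2" by presburger
    then show ?thesis using True by (simp add: hat_graph_def hat_size_def)
  next
    case False
    then have "n div 2 - 1 = (n - 1) div 2" "n div 2 + 1 = n - (n - 1) div 2"
      using assms by presburger+
    then show ?thesis using False by (simp add: hat_graph_def hat_size_def)
  qed
  \<comment> \<open>The alternatives are odd and even \<open>n\<close>; in the even case the vertex
    with the last index lies outside both \<open>S\<close> and \<open>I\<close>.\<close>
  have size: "n - ?s = Suc ?s \<or> n - ?s = Suc (Suc ?s)" "?s > 0"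
    using assms(1) unfolding hat_size_def by presburger+
  have V: "pverts ?G = Inl ` {..<?s} \<union> Inr ` {..<n - ?s}"
    by (auto simp: G graph_join_def disjoint_union_def complete_graph_def edgeless_graph_def)
  show "join_partition (pverts ?G) S I n ?s"
  proof
    show "card (pverts ?G) = n" using assms by (intro card_pverts_hat_graph) simp
    show "card I = Suc ?s" by (simp add: I_def card_image)
    show "I \<subseteq> pverts ?G" using size by (auto simp: V I_def)
  qed (use size in \<open>auto simp: V S_def I_def card_image\<close>)
  have "parcs ?G = parcs (join_graph (pverts ?G) S I)"
    using size(1) unfolding join_graph_def V S_def I_def
    by (auto simp: G graph_join_def disjoint_union_def complete_graph_def edgeless_graph_def
        inj_image_mem_iff less_Suc_eq)
  then show "?G = join_graph (pverts ?G) S I"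
    by (intro pair_pre_digraph.equality) (simp_all add: join_graph_def)
qed

section \<open>Separation of largest eigenvalues by explicit numbers\<close>

text \<open>Taylor expansion at \<open>q\<close>: the last assumption is that the derivative at
  \<open>q\<close> is nonnegative, and the higher coefficients are nonnegative too, so no root lies
  beyond \<open>q\<close>.\<close>

lemma quotient_poly_pos:
  assumes "quotient_poly n s q > 0" "q \<ge> 0" "s \<le> n" "r \<ge> 0"
    and "3 * q\<^sup>2 + 2 * (n - s) * q - 4 * n + 4 - s * (5 * n - 12) + 8 * s\<^sup>2 \<ge> 0"
  shows "quotient_poly n s (q + r) > 0"
proof -
  have "quotient_poly n s (q + r) = quotient_poly n s q
     + r * (3 * q\<^sup>2 + 2 * (n - s) * q - 4 * n + 4 - s * (5 * n - 12) + 8 * s\<^sup>2)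
     + r\<^sup>2 * (3 * q + (n - s)) + r ^ 3"
    unfolding quotient_poly_def by (simp add: algebra_simps power2_eq_square power3_eq_cube)
  moreover have "r * (3 * q\<^sup>2 + 2 * (n - s) * q - 4 * n + 4 - s * (5 * n - 12) + 8 * s\<^sup>2) \<ge> 0"
    "r\<^sup>2 * (3 * q + (n - s)) \<ge> 0" "r ^ 3 \<ge> 0"
    using assms by (auto intro!: mult_nonneg_nonneg)
  ultimately show ?thesis using assms(1) by linarith
qed

text \<open>After the shift by \<open>2n - 2\<close>, the number \<open>q\<close> lies below the
  largest root for \<open>s\<close> and above the one for \<open>t\<close>.\<close>

lemma eta_less_by_separator:
  assumes "join_partition V S I n s" "join_partition V' S' I' n t"
    and "quotient_poly n s q < 0" "q \<ge> 0"
    and "quotient_poly n t q > 0"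
    and "3 * q\<^sup>2 + 2 * (real n - t) * q - 4 * real n + 4 - t * (5 * real n - 12) + 8 * (real t)\<^sup>2 \<ge> 0"
  shows "eta (join_graph V' S' I') < eta (join_graph V S I)"
proof -
  interpret A: join_partition V S I n s by fact
  interpret B: join_partition V' S' I' n t by fact
  define Y where "Y = eta (join_graph V' S' I') - 2 * real n + 2"
  have root: "quotient_poly n t Y = 0"
    unfolding Y_def by (rule B.quotient_poly_top[OF B.top_eigenvalue_join_graph])
  have "Y < q"
  proof (rule ccontr)
    assume "\<not> Y < q"
    then have "quotient_poly n t (q + (Y - q)) > 0"
      using assms B.size_le by (intro quotient_poly_pos) auto
    with root show False by simp
  qed
  then show ?thesis using A.top_greater[OF A.top_eigenvalue_join_graph assms(3,4)] by (simp add: Y_def)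
qed

lemma eta_pendant_less:
  assumes "join_partition V S I n s" "join_partition V' S' I' n 1"
    and n: "n \<ge> 16 \<or> n \<in> {12, 14}" and "s \<noteq> 1"
  shows "eta (join_graph V' S' I') < eta (join_graph V S I)"
proof -
  interpret A: join_partition V S I n s by fact
  interpret B: join_partition V' S' I' n 1 by fact
  have s: "s \<ge> 2" "2 * s + 1 \<le> n" using A.s_pos A.size_le assms(4) by auto
  consider "n = 12" | "n = 14" | "n = 16" | "n \<ge> 17" using n by force
  then show ?thesis
  proof cases
    case 1
    \<comment> \<open>The largest roots for \<open>s = 1\<close> and \<open>s = 5\<close> both lie
      strictly between 9 and 10, so no integer can separate them.\<close>
    then have "s \<in> {2, 3, 4, 5}" using s by auto
    then show ?thesis using 1
      by (intro eta_less_by_separator[OF assms(1,2), of "91 / 10"])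
        (auto simp: quotient_poly_def power2_eq_square power3_eq_cube)
  next
    case 2
    then have "s \<in> {2, 3, 4, 5, 6}" using s by auto
    then show ?thesis using 2
      by (intro eta_less_by_separator[OF assms(1,2), of 10])
        (auto simp: quotient_poly_def power2_eq_square power3_eq_cube)
  next
    case 3
    then have "s \<in> {2, 3, 4, 5, 6, 7}" using s by auto
    then show ?thesis using 3
      by (intro eta_less_by_separator[OF assms(1,2), of 11])
        (auto simp: quotient_poly_def power2_eq_square power3_eq_cube)
  next
    case 4
    let ?X = "eta (join_graph V' S' I') - 2 * real n + 2"
    have X: "quotient_poly n 1 ?X = 0" "?X > 0"
      using B.quotient_poly_top[OF B.top_eigenvalue_join_graph] B.top_pos[OF B.top_eigenvalue_join_graph]
      by auto
    \<comment> \<open>For large \<open>n\<close> the exact root for \<open>s = 1\<close> is itself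
      the point of comparison.\<close>
    have "quotient_poly n s ?X < 0"
      by (rule quotient_poly_neg_of_pendant_root) (use X s 4 in auto)
    then show ?thesis
      using A.top_greater[OF A.top_eigenvalue_join_graph, of ?X] X(2) by simp
  qed
qed

text \<open>Only finitely many pairs of \<open>n\<close> and \<open>s\<close> occur. Each separator
  exceeds the largest root for \<open>hat_size n\<close> and lies below those for all other
  admissible \<open>s\<close>.\<close>

lemma eta_hat_less:
  assumes "join_partition V S I n s" "join_partition V' S' I' n (hat_size n)"
    and n: "3 \<le> n \<and> n \<le> 11 \<or> n = 13 \<or> n = 15" and "s \<noteq> hat_size n"
  shows "eta (join_graph V' S' I') < eta (join_graph V S I)"
proof -
  interpret A: join_partition V S I n s by fact
  have s: "s \<ge> 1" "2 * s + 1 \<le> n" using A.s_pos A.size_le by auto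
  note sep = eta_less_by_separator[OF assms(1,2)]
  note simps = quotient_poly_def power2_eq_square power3_eq_cube hat_size_def
  \<comment> \<open>For these orders \<open>s = 1 = hat_size n\<close> is the only
    possibility.\<close>
  have "n \<noteq> 3" "n \<noteq> 4" using s assms(4) by (auto simp: hat_size_def)
  with n have "n \<in> {5, 6, 7, 8, 9, 10, 11, 13, 15}" by auto
  then consider "n = 5" | "n = 6" | "n = 7" | "n = 8" | "n = 9" | "n = 10" | "n = 11" | "n = 13" | "n = 15"
    by auto
  then show ?thesis
  proof cases
    case 1
    then have "s = 1" using s assms(4) by (auto simp: hat_size_def)
    then show ?thesis using 1 by (intro sep[of 4]) (auto simp: simps)
  next
    case 2
    then have "s = 1" using s assms(4) by (auto simp: hat_size_def)
    then show ?thesis using 2 by (intro sep[of 5]) (auto simp: simps)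
  next
    case 3
    then have "s \<in> {1, 2}" using s assms(4) by (auto simp: hat_size_def)
    then show ?thesis using 3 by (intro sep[of 5]) (auto simp: simps)
  next
    case 4
    then have "s \<in> {1, 2}" using s assms(4) by (auto simp: hat_size_def)
    then show ?thesis using 4 by (intro sep[of "13 / 2"]) (auto simp: simps)
  next
    case 5
    then have "s \<in> {1, 2, 3}" using s assms(4) by (auto simp: hat_size_def)
    then show ?thesis using 5 by (intro sep[of 6]) (auto simp: simps)
  next
    case 6
    then have "s \<in> {1, 2, 3}" using s assms(4) by (auto simp: hat_size_def)
    then show ?thesis using 6 by (intro sep[of 8]) (auto simp: simps)
  next
    case 7
    then have "s \<in> {1, 2, 3, 4}" using s assms(4) by (auto simp: hat_size_def)
    then show ?thesis using 7 by (intro sep[of 8]) (auto simp: simps)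
  next
    case 8
    then have "s \<in> {1, 2, 3, 4, 5}" using s assms(4) by (auto simp: hat_size_def)
    then show ?thesis using 8 by (intro sep[of 9]) (auto simp: simps)
  next
    case 9
    then have "s \<in> {1, 2, 3, 4, 5, 6}" using s assms(4) by (auto simp: hat_size_def)
    then show ?thesis using 9 by (intro sep[of "51 / 5"]) (auto simp: simps)
  qed
qed

text \<open>Without a factor, \<open>G\<close> is a spanning subgraph of some
  \<open>H\<^sub>s\<close>, so \<open>eta G\<close> is at least the value for
  \<open>H\<^sub>s\<close>. The assumption \<open>less\<close> leaves only \<open>s = t\<close>, and
  then equality forces \<open>G\<close> to be the whole join.\<close>

lemma factor_or_iso:
  fixes G :: "'a pair_pre_digraph"
  assumes G: "pair_graph G" "Digraph_Component.connected (with_proj G)" "card (pverts G) = n" "n \<ge> 3"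
    and T: "join_partition V' S' I' n t" "T = join_graph V' S' I'"
    and less: "\<And>(V :: 'a set) S I s. join_partition V S I n s \<Longrightarrow> s \<noteq> t \<Longrightarrow> eta T < eta (join_graph V S I)"
    and "eta G \<le> eta T"
  shows "graph_iso G T \<or> has_K2_Ck_factor G"
proof (rule ccontr)
  assume no: "\<not> ?thesis"
  interpret connected_graph G using G by (simp add: connected_graph_def connected_graph_axioms_def)
  obtain S I where SI: "S \<subseteq> pverts G" "I \<subseteq> pverts G" "S \<inter> I = {}" "card I = Suc (card S)"
    "\<And>u w. u \<in> I \<Longrightarrow> (u, w) \<in> parcs G \<Longrightarrow> w \<in> S"
    using no_factor_deficiency[OF G(1)] no by metis
  \<comment> \<open>Otherwise a vertex of \<open>I\<close> would have no neighbour, although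
    \<open>G\<close> is connected with at least 3 vertices.\<close>
  have "S \<noteq> {}"
  proof
    assume "S = {}"
    obtain u where u: "u \<in> I" using SI(4) by fastforce
    then have "pverts G - {u} \<noteq> {}"
      using G(3,4) SI(2) card_Diff_singleton[of u "pverts G"] by (metis One_nat_def card.empty
        diff_is_0_eq not_less_eq_eq numeral_3_eq_3 subsetD le_SucI nat_le_linear Suc_n_not_le_n)
    then obtain v where v: "v \<in> pverts G" "v \<noteq> u" by auto
    obtain p where p: "apath u p v" using gdist_attained[of u v] u v SI(2) by blast
    then obtain e q where "p = e # q" using v(2) by (cases p) (auto simp: apath_Nil_iff)
    then have "(u, snd e) \<in> parcs G" using p by (cases e) (auto simp: apath_Cons_iff)
    then show False using SI(5)[OF u] \<open>S = {}\<close> by auto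
  qed
  then have part: "join_partition (pverts G) S I n (card S)"
    using SI G(3) finite_subset[OF SI(1)] by unfold_locales (auto simp: card_gt_0_iff)
  interpret H: join_partition "pverts G" S I n "card S" by fact
  note sub = H.eta_subgraph[OF connected_graph_axioms refl SI(5)]
  have "card S = t" using less[OF part] sub(1) assms(8) by force
  then have part': "join_partition (pverts G) S I n t" using part by simp
  interpret B: join_partition V' S' I' n t by fact
  \<comment> \<open>The two joins live on different vertex types, so their values are matched
    through the common cubic.\<close>
  have "eta (join_graph (pverts G) S I) = eta T"
    unfolding T(2) by (rule top_eigenvalue_join_eq[OF part' T(1)])
      (rule H.top_eigenvalue_join_graph B.top_eigenvalue_join_graph)+
  then have "G = join_graph (pverts G) S I" using sub assms(8) by (intro sub(2)) auto
  then have "graph_iso G T" using graph_iso_join_graph[OF part' T(1)] T(2) by simp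
  with no show False by simp
qed

theorem theorem4p1:
  fixes G :: "'a pair_pre_digraph" and n :: nat
  assumes "pair_graph G"
    and "Digraph_Component.connected (with_proj G)"
    and "card (pverts G) = n"
  shows "((n \<ge> 16 \<or> n \<in> {12, 14}) \<and> eta G \<le> eta (pendant_graph n)
            \<longrightarrow> \<not> graph_iso G (pendant_graph n) \<longrightarrow> has_K2_Ck_factor G)
       \<and> ((3 \<le> n \<and> n \<le> 11 \<or> n = 13 \<or> n = 15) \<and> eta G \<le> eta (hat_graph n)
            \<longrightarrow> \<not> graph_iso G (hat_graph n) \<longrightarrow> has_K2_Ck_factor G)"
proof (intro conjI impI; elim conjE)
  assume n: "n \<ge> 16 \<or> n \<in> {12, 14}" and le: "eta G \<le> eta (pendant_graph n)"
    and no: "\<not> graph_iso G (pendant_graph n)"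
  have n3: "n \<ge> 3" using n by auto
  note P = pendant_graph_eq[OF n3]
  have less: "eta (pendant_graph n) < eta (join_graph V S I)"
    if "join_partition V S I n s" "s \<noteq> 1" for V S I :: "'a set" and s
    using eta_pendant_less[OF that(1) P(2) n that(2)] P(1) by simp
  have "graph_iso G (pendant_graph n) \<or> has_K2_Ck_factor G"
    by (rule factor_or_iso[OF assms n3 P(2,1) _ le]) (rule less)
  with no show "has_K2_Ck_factor G" by blast
next
  assume n: "3 \<le> n \<and> n \<le> 11 \<or> n = 13 \<or> n = 15" and le: "eta G \<le> eta (hat_graph n)"
    and no: "\<not> graph_iso G (hat_graph n)"
  have n3: "n \<ge> 3" using n by auto
  note P = hat_graph_eq[OF n3]
  have less: "eta (hat_graph n) < eta (join_graph V S I)"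
    if "join_partition V S I n s" "s \<noteq> hat_size n" for V S I :: "'a set" and s
    using eta_hat_less[OF that(1) P(2) n that(2)] P(1) by simp
  have "graph_iso G (hat_graph n) \<or> has_K2_Ck_factor G"
    by (rule factor_or_iso[OF assms n3 P(2,1) _ le]) (rule less)
  with no show "has_K2_Ck_factor G" by blast
qed

end
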